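(* Let $n$ be a finite horizon and $\lambda\in(0,1]$. (Type 1.) Consider the $n$-stage type 1 dual game $\tilde\Gamma^1_{n,\lambda}(\mu,q)$, and let $Y^*$ be player 2's optimal strategy at stage $1$ in it ($Y^*(b,l)$ is the probability of action $b$ in state $l$). Then $$w^1_{n,\lambda}(\mu,q)=\min\ \rho$$ over real variables $\rho$ and, for every $(a,b)\in\mathcal A\times\mathcal B$, $Z_0^{a,b}$, $Z^{a,b}_{\mathcal I_s}$ ($s=1,\dots,n$), $S^{a,b}_{\mathcal J_s}(b_s)$ ($s=1,\dots,n-1$), $\beta_{a,b}\in\mathbb R^{|\mathcal K|}$, subject to $$\rho\ge\mu(k)+\sum_{l,b}G_{k,l}(a,b)Y^*(b,l)q(l)+\lambda\sum_{l,b}Y^*(b,l)q(l)\Big(Z_0^{a,b}-\sum_{k'}P_{a,b}(k,k')\beta_{a,b}(k')\Big)\quad\forall a,k,$$ $$\beta_{a,b}(k)+Z^{a,b}_{\mathcal I_1}\le Z_0^{a,b}\quad\forall k,\ \mathcal I_1=\{k\},\ \forall a,b,$$ $$\sum_{l_1,\dots,l_s}\sum_{b_s}S^{a,b}_{\mathcal J_s}(b_s)\lambda^{s-1}G_{k_s,l_s}(a_s,b_s)+\sum_{k_{s+1}}\sum_{b_s}P_{a_s,b_s}(k_s,k_{s+1})Z^{a,b}_{\mathcal I_{s+1}}\le Z^{a,b}_{\mathcal I_s}\quad\forall s=1,\dots,n-1,\ \forall a_s,\ \forall\mathcal I_s,\ \forall a,b,$$ $$\sum_{b_t}S^{a,b}_{\mathcal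 J_t}(b_t)=Q_{a_{t-1},b_{t-1}}(l_{t-1},l_t)S^{a,b}_{\mathcal J_{t-1}}(b_{t-1})\quad\forall t=2,\dots,n-1,\ \forall\mathcal J_t,\ \forall a,b,$$ $$\sum_{b_1}S^{a,b}_{\mathcal J_1}(b_1)=q^+_{q,Y^*_{a,b}}(l_1)\quad\forall\mathcal J_1=\{l_1\},\ \forall a,b,$$ $$Z^{a,b}_{\mathcal I_n}=0\ \ \forall\mathcal I_n,\forall a,b,\qquad S^{a,b}_{\mathcal J_t}(b_t)\ge0\ \ \forall t=1,\dots,n-1,\ \forall\mathcal J_t,b_t,\ \forall a,b,$$ where $\mathcal I_{s+1}=(\mathcal I_s,a_s,b_s,k_{s+1})$. Moreover, with $\beta^*$ the $\beta$-part of an optimal solution, the vector payoff in stage $2$ is $\mu_2=\beta^*_{a_1,b_1}$, where $(a_1,b_1)$ is the action pair of stage 1. (Type 2.) Consider the $n$-stage type 2 dual game $\tilde\Gamma^2_{n,\lambda}(p,\nu)$, and let $X^*$ be player 1's optimal strategy at stage $1$ in it ($X^*(a,k)$ is the probability of action $a$ in state $k$). Then $$w^2_{n,\lambda}(p,\nu)=\max\ \varphi$$ over real variables $\varphi$ and, for every $(a,b)\in\mathcal A\times\mathcal B$, $U_0^{a,b}$, $U^{a,b}_{\mathcal J_s}$ ($s=1,\dots,n$), $R^{a,b}_{\mathcal I_s}(a_s)$ ($s=1,\dots,n-1$), $\alpha_{a,b}\in\mathbb R^{|\mathcal L|}$, subject to $$\varphi\le\nu(l)+\sum_{k,a}G_{k,l}(a,b)X^*(a,k)p(k)+\lambda\sum_{k,a}X^*(a,k)p(k)\Big(U_0^{a,b}-\sum_{l'}Q_{a,b}(l,l')\alpha_{a,b}(l')\Big)\quad\forall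 b,l,$$ $$\alpha_{a,b}(l)+U^{a,b}_{\mathcal J_1}\ge U_0^{a,b}\quad\forall l,\ \mathcal J_1=\{l\},\ \forall a,b,$$ $$\sum_{k_1,\dots,k_s}\sum_{a_s}R^{a,b}_{\mathcal I_s}(a_s)\lambda^{s-1}G_{k_s,l_s}(a_s,b_s)+\sum_{l_{s+1}}\sum_{a_s}Q_{a_s,b_s}(l_s,l_{s+1})U^{a,b}_{\mathcal J_{s+1}}\ge U^{a,b}_{\mathcal J_s}\quad\forall s=1,\dots,n-1,\ \forall b_s,\ \forall\mathcal J_s,\ \forall a,b,$$ $$\sum_{a_t}R^{a,b}_{\mathcal I_t}(a_t)=P_{a_{t-1},b_{t-1}}(k_{t-1},k_t)R^{a,b}_{\mathcal I_{t-1}}(a_{t-1})\quad\forall t=2,\dots,n-1,\ \forall\mathcal I_t,\ \forall a,b,$$ $$\sum_{a_1}R^{a,b}_{\mathcal I_1}(a_1)=p^+_{p,X^*_{a,b}}(k_1)\quad\forall\mathcal I_1=\{k_1\},\ \forall a,b,$$ $$U^{a,b}_{\mathcal J_n}=0\ \ \forall\mathcal J_n,\forall a,b,\qquad R^{a,b}_{\mathcal I_t}(a_t)\ge0\ \ \forall t=1,\dots,n-1,\ \forall\mathcal I_t,a_t,\ \forall a,b,$$ where $\mathcal J_{s+1}=(\mathcal J_s,a_s,b_s,l_{s+1})$. Moreover, with $\alpha^*$ the $\alpha$-part of an optimal solution, the vector payoff in stage $2$ is $\nu_2=\alpha^*_{a_1,b_1}$.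
   Context: Primal game. $\mathcal K,\mathcal L$ (states of players 1, 2) and $\mathcal A,\mathcal B$ (actions of players 1, 2) are non-empty finite sets. $G_{k,l}\in\mathbb R^{|\mathcal A|\times|\mathcal B|}$ has non-negative entries $G_{k,l}(a,b)$ (payoff to player 1, cost to player 2). $p\in\Delta(\mathcal K)$, $q\in\Delta(\mathcal L)$ are initial distributions. For each $(a,b)$, $P_{a,b}(k,k')$ and $Q_{a,b}(l,l')$ are transition probabilities (row-stochastic). In the primal game, $k_1\sim p$ and $l_1\sim q$ are drawn independently by nature; for $t\ge2$, $k_t$ and $l_t$ are drawn independently according to $P_{a_{t-1},b_{t-1}}(k_{t-1},\cdot)$ and $Q_{a_{t-1},b_{t-1}}(l_{t-1},\cdot)$. Player 1 sees only the states $k_t$, player 2 only the states $l_t$. At every stage the players choose $a_t,b_t$ simultaneously and both then observe $(a_t,b_t)$; payoffs are not observed during play. $\mathcal I_t=(k_1,a_1,b_1,\dots,k_{t-1},a_{t-1},b_{t-1},k_t)$ and $\mathcal J_t=(l_1,a_1,b_1,\dots,l_{t-1},a_{t-1},b_{t-1},l_t)$ are the information of players 1 and 2 at stage $t$. Behavior strategies are $\sigma=(\sigma_t)$, $\tau=(\tau_t)$ with $\sigma_t(\mathcal I_t)\in\Delta(\mathcal A)$, $\tau_t(\mathcal J_t)\in\Delta(\mathcal B)$. Dual games (player 1 maximizes, player 2 minimizes). The type 1 dual game $\tilde\Gamma^1_{n,\lambda}(\mu,q)$, $\mu\in\mathbb R^{|\mathcal K|}$, is played as the primal game except that player 1 itself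 chooses the distribution $p\in\Delta(\mathcal K)$ of its initial state (as part of its strategy, unobserved by player 2); its payoff is $E_{p,q,\sigma,\tau}\big(\mu(k_1)+\sum_{t=1}^n\lambda^{t-1}G_{k_t,l_t}(a_t,b_t)\big)$, and $w^1_{n,\lambda}(\mu,q)$ is its value. The type 2 dual game $\tilde\Gamma^2_{n,\lambda}(p,\nu)$, $\nu\in\mathbb R^{|\mathcal L|}$, is played as the primal game except that player 2 itself chooses the distribution $q\in\Delta(\mathcal L)$ of its initial state (unobserved by player 1); its payoff is $E_{p,q,\sigma,\tau}\big(\nu(l_1)+\sum_{t=1}^n\lambda^{t-1}G_{k_t,l_t}(a_t,b_t)\big)$, and $w^2_{n,\lambda}(p,\nu)$ is its value. An optimal strategy at stage 1 is the stage-1 component of a strategy guaranteeing the value. With zero stages, $w^1_{0,\lambda}(\mu,q)=\max_k\mu(k)$ and $w^2_{0,\lambda}(p,\nu)=\min_l\nu(l)$. Belief updates. For $X(\cdot,k)\in\Delta(\mathcal A)$, $Y(\cdot,l)\in\Delta(\mathcal B)$ put $\bar x_{p,X}(a)=\sum_kp(k)X(a,k)$, $\bar y_{q,Y}(b)=\sum_lq(l)Y(b,l)$. After the action pair $(a,b)$, $$p^+_{p,X}(k')=\sum_kP_{a,b}(k,k')\frac{p(k)X(a,k)}{\bar x_{p,X}(a)},\qquad q^+_{q,Y}(l')=\sum_lQ_{a,b}(l,l')\frac{q(l)Y(b,l)}{\bar y_{q,Y}(b)};$$ these depend on $(a,b)$, and $p^+_{p,X^*_{a,b}}$, $q^+_{q,Y^*_{a,b}}$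 denote them for $X=X^*$, $Y=Y^*$ and the action pair $(a,b)$ (an arbitrary probability vector if the denominator is $0$). Vector payoffs. In the type 1 dual game the stage-2 vector payoff is by definition $\mu_2=\beta^*_{a_1,b_1}$, where $\beta^*=(\beta^*_{a,b})_{a,b}$ is (the $\beta$-part of) an optimal solution of $$w^1_{n,\lambda}(\mu,q)=\min_Y\min_{(\beta_{a,b})}\max_{\Pi\in\Delta(\mathcal A\times\mathcal K)}\sum_{a,k}\Pi(a,k)\Big[\mu(k)+\sum_{l,b}G_{k,l}(a,b)Y(b,l)q(l)+\lambda\sum_b\bar y_{q,Y}(b)\Big(w^1_{n-1,\lambda}(\beta_{a,b},q^+_{q,Y})-\sum_{k'}P_{a,b}(k,k')\beta_{a,b}(k')\Big)\Big].$$ In the type 2 dual game the stage-2 vector payoff is $\nu_2=\alpha^*_{a_1,b_1}$, where $\alpha^*$ is (the $\alpha$-part of) an optimal solution of $$w^2_{n,\lambda}(p,\nu)=\max_X\max_{(\alpha_{a,b})}\min_{\Psi\in\Delta(\mathcal B\times\mathcal L)}\sum_{b,l}\Psi(b,l)\Big[\nu(l)+\sum_{k,a}G_{k,l}(a,b)X(a,k)p(k)+\lambda\sum_a\bar x_{p,X}(a)\Big(w^2_{n-1,\lambda}(p^+_{p,X},\alpha_{a,b})-\sum_{l'}Q_{a,b}(l,l')\alpha_{a,b}(l')\Big)\Big].$$ So the assertions about $\mu_2$, $\nu_2$ mean that the LP's $\beta^*$ together with $Y^*$ (resp. $\alpha^*$ together with $X^*$) solves the corresponding problem. Conventions. In $\sum_{k_1,\dots,k_s}R_{\mathcal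 I_s}(a_s)$ with $\mathcal J_s$ fixed, $\mathcal I_s$ is formed from $k_1,\dots,k_s$ and the actions contained in $\mathcal J_s$; symmetrically for $\sum_{l_1,\dots,l_s}S_{\mathcal J_s}(b_s)$ with $\mathcal I_s$ fixed. For $\mathcal I_t$, $t\ge2$, the quantities $\mathcal I_{t-1},a_{t-1},b_{t-1},k_{t-1}$ are those contained in $\mathcal I_t$ (similarly for $\mathcal J_t$). *)

theory Defs
  imports "HOL-Probability.Probability"
begin

text \<open>
  The finite state and action sets of the two players are the types \<open>'k\<close>, \<open>'l\<close>, \<open>'a\<close>, \<open>'b\<close> of
  class \<open>finite\<close>.  The information
  \<open>(k\<^sub>1, a\<^sub>1, b\<^sub>1, \<dots>, k\<^sub>t\<^sub>-\<^sub>1, a\<^sub>t\<^sub>-\<^sub>1, b\<^sub>t\<^sub>-\<^sub>1, k\<^sub>t)\<close> of player 1 at stage \<open>t\<close> is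
  represented by the two chronological lists \<open>ks = [k\<^sub>1, \<dots>, k\<^sub>t]\<close> and
  \<open>hs = [(a\<^sub>1, b\<^sub>1), \<dots>, (a\<^sub>t\<^sub>-\<^sub>1, b\<^sub>t\<^sub>-\<^sub>1)]\<close>; likewise \<open>ls\<close> and \<open>hs\<close> for player 2.  Thus \<open>ks\<close>
  and \<open>ls\<close> with the same \<open>hs\<close> are private histories sharing the same actions.
\<close>

type_synonym ('s, 'a, 'b, 'c) strategy = "'s list \<Rightarrow> ('a \<times> 'b) list \<Rightarrow> 'c pmf"

definition is_info :: "nat \<Rightarrow> 's list \<Rightarrow> ('a \<times> 'b) list \<Rightarrow> bool" where
  "is_info t ss hs \<longleftrightarrow> length ss = t \<and> Suc (length hs) = t"


subsection \<open>Plays and payoffs\<close>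

definition stage ::
  "('a \<Rightarrow> 'b \<Rightarrow> 'k \<Rightarrow> 'k pmf) \<Rightarrow> ('a \<Rightarrow> 'b \<Rightarrow> 'l \<Rightarrow> 'l pmf) \<Rightarrow>
   ('k, 'a, 'b, 'a) strategy \<Rightarrow> ('l, 'a, 'b, 'b) strategy \<Rightarrow>
   'k list \<times> 'l list \<times> ('a \<times> 'b) list \<Rightarrow> ('k list \<times> 'l list \<times> ('a \<times> 'b) list) pmf" where
  "stage P Q \<sigma> \<tau> = (\<lambda>(ks, ls, hs). do {
     a \<leftarrow> \<sigma> ks hs;
     b \<leftarrow> \<tau> ls hs;
     k' \<leftarrow> P a b (last ks);
     l' \<leftarrow> Q a b (last ls);
     return_pmf (ks @ [k'], ls @ [l'], hs @ [(a, b)])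
   })"

text \<open>After \<open>n\<close> stages the states of stage \<open>n + 1\<close> have been drawn as well; they do not enter
  the \<open>n\<close>-stage payoff.\<close>

primrec play ::
  "('a \<Rightarrow> 'b \<Rightarrow> 'k \<Rightarrow> 'k pmf) \<Rightarrow> ('a \<Rightarrow> 'b \<Rightarrow> 'l \<Rightarrow> 'l pmf) \<Rightarrow> 'k pmf \<Rightarrow> 'l pmf \<Rightarrow>
   ('k, 'a, 'b, 'a) strategy \<Rightarrow> ('l, 'a, 'b, 'b) strategy \<Rightarrow>
   nat \<Rightarrow> ('k list \<times> 'l list \<times> ('a \<times> 'b) list) pmf" where
  "play P Q p q \<sigma> \<tau> 0 = do { k \<leftarrow> p; l \<leftarrow> q; return_pmf ([k], [l], []) }"
| "play P Q p q \<sigma> \<tau> (Suc n) = do { h \<leftarrow> play P Q p q \<sigma> \<tau> n; stage P Q \<sigma> \<tau> h }"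

definition total_payoff ::
  "('k \<Rightarrow> 'l \<Rightarrow> 'a \<Rightarrow> 'b \<Rightarrow> real) \<Rightarrow> nat \<Rightarrow> real \<Rightarrow> 'k list \<Rightarrow> 'l list \<Rightarrow> ('a \<times> 'b) list \<Rightarrow> real" where
  "total_payoff G n lam ks ls hs =
     (\<Sum>t<n. lam ^ t * G (ks ! t) (ls ! t) (fst (hs ! t)) (snd (hs ! t)))"

definition payoff1 ::
  "('k \<Rightarrow> 'l \<Rightarrow> 'a \<Rightarrow> 'b \<Rightarrow> real) \<Rightarrow> ('a \<Rightarrow> 'b \<Rightarrow> 'k \<Rightarrow> 'k pmf) \<Rightarrow> ('a \<Rightarrow> 'b \<Rightarrow> 'l \<Rightarrow> 'l pmf) \<Rightarrow>
   nat \<Rightarrow> real \<Rightarrow> ('k \<Rightarrow> real) \<Rightarrow> 'k pmf \<Rightarrow> 'l pmf \<Rightarrow>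
   ('k, 'a, 'b, 'a) strategy \<Rightarrow> ('l, 'a, 'b, 'b) strategy \<Rightarrow> real" where
  "payoff1 G P Q n lam \<mu> p q \<sigma> \<tau> =
     measure_pmf.expectation (play P Q p q \<sigma> \<tau> n)
       (\<lambda>(ks, ls, hs). \<mu> (hd ks) + total_payoff G n lam ks ls hs)"

definition payoff2 ::
  "('k \<Rightarrow> 'l \<Rightarrow> 'a \<Rightarrow> 'b \<Rightarrow> real) \<Rightarrow> ('a \<Rightarrow> 'b \<Rightarrow> 'k \<Rightarrow> 'k pmf) \<Rightarrow> ('a \<Rightarrow> 'b \<Rightarrow> 'l \<Rightarrow> 'l pmf) \<Rightarrow>
   nat \<Rightarrow> real \<Rightarrow> ('l \<Rightarrow> real) \<Rightarrow> 'k pmf \<Rightarrow> 'l pmf \<Rightarrow>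
   ('k, 'a, 'b, 'a) strategy \<Rightarrow> ('l, 'a, 'b, 'b) strategy \<Rightarrow> real" where
  "payoff2 G P Q n lam \<nu> p q \<sigma> \<tau> =
     measure_pmf.expectation (play P Q p q \<sigma> \<tau> n)
       (\<lambda>(ks, ls, hs). \<nu> (hd ls) + total_payoff G n lam ks ls hs)"


subsection \<open>Values and optimal strategies of the dual games\<close>

text \<open>The value of the zero-sum game in which the maximizer picks \<open>s\<close> and the minimizer picks
  \<open>t\<close>: the common value of the lower and the upper value (unspecified if they differ).  It is
  only used for bounded \<open>f\<close>, where the real suprema and infima are the intended ones.\<close>

definition game_value :: "('s \<Rightarrow> 't \<Rightarrow> real) \<Rightarrow> real" where
  "game_value f = (THE v. (SUP s. INF t. f s t) = v \<and> (INF t. SUP s. f s t) = v)"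

definition w1 ::
  "('k::finite \<Rightarrow> 'l::finite \<Rightarrow> 'a::finite \<Rightarrow> 'b::finite \<Rightarrow> real) \<Rightarrow>
   ('a \<Rightarrow> 'b \<Rightarrow> 'k \<Rightarrow> 'k pmf) \<Rightarrow> ('a \<Rightarrow> 'b \<Rightarrow> 'l \<Rightarrow> 'l pmf) \<Rightarrow>
   nat \<Rightarrow> real \<Rightarrow> ('k \<Rightarrow> real) \<Rightarrow> 'l pmf \<Rightarrow> real" where
  "w1 G P Q n lam \<mu> q = game_value (\<lambda>(p, \<sigma>) \<tau>. payoff1 G P Q n lam \<mu> p q \<sigma> \<tau>)"

definition w2 ::
  "('k::finite \<Rightarrow> 'l::finite \<Rightarrow> 'a::finite \<Rightarrow> 'b::finite \<Rightarrow> real) \<Rightarrow>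
   ('a \<Rightarrow> 'b \<Rightarrow> 'k \<Rightarrow> 'k pmf) \<Rightarrow> ('a \<Rightarrow> 'b \<Rightarrow> 'l \<Rightarrow> 'l pmf) \<Rightarrow>
   nat \<Rightarrow> real \<Rightarrow> 'k pmf \<Rightarrow> ('l \<Rightarrow> real) \<Rightarrow> real" where
  "w2 G P Q n lam p \<nu> = game_value (\<lambda>\<sigma> (q, \<tau>). payoff2 G P Q n lam \<nu> p q \<sigma> \<tau>)"

definition optimal_stage1_player2 ::
  "('k::finite \<Rightarrow> 'l::finite \<Rightarrow> 'a::finite \<Rightarrow> 'b::finite \<Rightarrow> real) \<Rightarrow>
   ('a \<Rightarrow> 'b \<Rightarrow> 'k \<Rightarrow> 'k pmf) \<Rightarrow> ('a \<Rightarrow> 'b \<Rightarrow> 'l \<Rightarrow> 'l pmf) \<Rightarrow>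
   nat \<Rightarrow> real \<Rightarrow> ('k \<Rightarrow> real) \<Rightarrow> 'l pmf \<Rightarrow> ('l \<Rightarrow> 'b pmf) \<Rightarrow> bool" where
  "optimal_stage1_player2 G P Q n lam \<mu> q Y \<longleftrightarrow>
     (\<exists>\<tau>. (\<forall>p \<sigma>. payoff1 G P Q n lam \<mu> p q \<sigma> \<tau> \<le> w1 G P Q n lam \<mu> q) \<and>
          (\<forall>l. Y l = \<tau> [l] []))"

definition optimal_stage1_player1 ::
  "('k::finite \<Rightarrow> 'l::finite \<Rightarrow> 'a::finite \<Rightarrow> 'b::finite \<Rightarrow> real) \<Rightarrow>
   ('a \<Rightarrow> 'b \<Rightarrow> 'k \<Rightarrow> 'k pmf) \<Rightarrow> ('a \<Rightarrow> 'b \<Rightarrow> 'l \<Rightarrow> 'l pmf) \<Rightarrow>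
   nat \<Rightarrow> real \<Rightarrow> 'k pmf \<Rightarrow> ('l \<Rightarrow> real) \<Rightarrow> ('k \<Rightarrow> 'a pmf) \<Rightarrow> bool" where
  "optimal_stage1_player1 G P Q n lam p \<nu> X \<longleftrightarrow>
     (\<exists>\<sigma>. (\<forall>q \<tau>. w2 G P Q n lam p \<nu> \<le> payoff2 G P Q n lam \<nu> p q \<sigma> \<tau>) \<and>
          (\<forall>k. X k = \<sigma> [k] []))"


subsection \<open>Belief updates\<close>

definition action_prob :: "'s::finite pmf \<Rightarrow> ('s \<Rightarrow> 'c pmf) \<Rightarrow> 'c \<Rightarrow> real" where
  "action_prob r X c = (\<Sum>s\<in>UNIV. pmf r s * pmf (X s) c)"

text \<open>\<open>r'\<close> is the belief about the next state, if the prior on the current state is \<open>r\<close>, the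
  mixed actions are given by \<open>X\<close>, the action \<open>c\<close> is observed and \<open>T\<close> is the transition kernel.
  If \<open>c\<close> has probability \<open>0\<close>, then \<open>r'\<close> is arbitrary.\<close>

definition belief_update ::
  "('s::finite \<Rightarrow> 's pmf) \<Rightarrow> 's pmf \<Rightarrow> ('s \<Rightarrow> 'c pmf) \<Rightarrow> 'c \<Rightarrow> 's pmf \<Rightarrow> bool" where
  "belief_update T r X c r' \<longleftrightarrow>
     (action_prob r X c \<noteq> 0 \<longrightarrow>
        (\<forall>s'. pmf r' s' =
           (\<Sum>s\<in>UNIV. pmf (T s) s' * (pmf r s * pmf (X s) c / action_prob r X c))))"


subsection \<open>The linear programs\<close>

text \<open>The variables \<open>Z\<close> and \<open>S\<close> (and below \<open>U\<close> and \<open>R\<close>) are total functions; only their values at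
  histories occurring in the constraints matter.  For \<open>n = 1\<close> the program has no variable \<open>S\<close>;
  the constraint on \<open>S a b [l] []\<close> below is then void, as \<open>S\<close> occurs in no other constraint.\<close>

definition lp1_feasible ::
  "('k::finite \<Rightarrow> 'l::finite \<Rightarrow> 'a::finite \<Rightarrow> 'b::finite \<Rightarrow> real) \<Rightarrow>
   ('a \<Rightarrow> 'b \<Rightarrow> 'k \<Rightarrow> 'k pmf) \<Rightarrow> ('a \<Rightarrow> 'b \<Rightarrow> 'l \<Rightarrow> 'l pmf) \<Rightarrow>
   nat \<Rightarrow> real \<Rightarrow> ('k \<Rightarrow> real) \<Rightarrow> 'l pmf \<Rightarrow> ('l \<Rightarrow> 'b pmf) \<Rightarrow> ('a \<Rightarrow> 'b \<Rightarrow> 'l pmf) \<Rightarrow>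
   real \<Rightarrow> ('a \<Rightarrow> 'b \<Rightarrow> real) \<Rightarrow> ('a \<Rightarrow> 'b \<Rightarrow> 'k list \<Rightarrow> ('a \<times> 'b) list \<Rightarrow> real) \<Rightarrow>
   ('a \<Rightarrow> 'b \<Rightarrow> 'l list \<Rightarrow> ('a \<times> 'b) list \<Rightarrow> 'b \<Rightarrow> real) \<Rightarrow> ('a \<Rightarrow> 'b \<Rightarrow> 'k \<Rightarrow> real) \<Rightarrow> bool" where
  "lp1_feasible G P Q n lam \<mu> q Y qplus \<rho> Z0 Z S \<beta> \<longleftrightarrow>
     (\<forall>a k. \<rho> \<ge> \<mu> k
        + (\<Sum>l\<in>UNIV. \<Sum>b\<in>UNIV. G k l a b * pmf (Y l) b * pmf q l)
        + lam * (\<Sum>l\<in>UNIV. \<Sum>b\<in>UNIV. pmf (Y l) b * pmf q l *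
                   (Z0 a b - (\<Sum>k'\<in>UNIV. pmf (P a b k) k' * \<beta> a b k')))) \<and>
     (\<forall>a b k. \<beta> a b k + Z a b [k] [] \<le> Z0 a b) \<and>
     (\<forall>a b. \<forall>s\<in>{1..n-1}. \<forall>ks hs as. is_info s ks hs \<longrightarrow>
        (\<Sum>ls | length ls = s. \<Sum>bs\<in>UNIV.
           S a b ls hs bs * lam ^ (s - 1) * G (last ks) (last ls) as bs)
        + (\<Sum>k'\<in>UNIV. \<Sum>bs\<in>UNIV. pmf (P as bs (last ks)) k' * Z a b (ks @ [k']) (hs @ [(as, bs)]))
        \<le> Z a b ks hs) \<and>
     (\<forall>a b. \<forall>t\<in>{2..n-1}. \<forall>ls hs a' b' l'. is_info (t - 1) ls hs \<longrightarrow>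
        (\<Sum>bt\<in>UNIV. S a b (ls @ [l']) (hs @ [(a', b')]) bt)
        = pmf (Q a' b' (last ls)) l' * S a b ls hs b') \<and>
     (\<forall>a b l. (\<Sum>b1\<in>UNIV. S a b [l] [] b1) = pmf (qplus a b) l) \<and>
     (\<forall>a b ks hs. is_info n ks hs \<longrightarrow> Z a b ks hs = 0) \<and>
     (\<forall>a b. \<forall>t\<in>{1..n-1}. \<forall>ls hs bt. is_info t ls hs \<longrightarrow> S a b ls hs bt \<ge> 0)"

definition lp1_optimal ::
  "('k::finite \<Rightarrow> 'l::finite \<Rightarrow> 'a::finite \<Rightarrow> 'b::finite \<Rightarrow> real) \<Rightarrow>
   ('a \<Rightarrow> 'b \<Rightarrow> 'k \<Rightarrow> 'k pmf) \<Rightarrow> ('a \<Rightarrow> 'b \<Rightarrow> 'l \<Rightarrow> 'l pmf) \<Rightarrow>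
   nat \<Rightarrow> real \<Rightarrow> ('k \<Rightarrow> real) \<Rightarrow> 'l pmf \<Rightarrow> ('l \<Rightarrow> 'b pmf) \<Rightarrow> ('a \<Rightarrow> 'b \<Rightarrow> 'l pmf) \<Rightarrow>
   real \<Rightarrow> ('a \<Rightarrow> 'b \<Rightarrow> real) \<Rightarrow> ('a \<Rightarrow> 'b \<Rightarrow> 'k list \<Rightarrow> ('a \<times> 'b) list \<Rightarrow> real) \<Rightarrow>
   ('a \<Rightarrow> 'b \<Rightarrow> 'l list \<Rightarrow> ('a \<times> 'b) list \<Rightarrow> 'b \<Rightarrow> real) \<Rightarrow> ('a \<Rightarrow> 'b \<Rightarrow> 'k \<Rightarrow> real) \<Rightarrow> bool" where
  "lp1_optimal G P Q n lam \<mu> q Y qplus \<rho> Z0 Z S \<beta> \<longleftrightarrow>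
     lp1_feasible G P Q n lam \<mu> q Y qplus \<rho> Z0 Z S \<beta> \<and>
     (\<forall>\<rho>' Z0' Z' S' \<beta>'. lp1_feasible G P Q n lam \<mu> q Y qplus \<rho>' Z0' Z' S' \<beta>' \<longrightarrow> \<rho> \<le> \<rho>')"

definition lp2_feasible ::
  "('k::finite \<Rightarrow> 'l::finite \<Rightarrow> 'a::finite \<Rightarrow> 'b::finite \<Rightarrow> real) \<Rightarrow>
   ('a \<Rightarrow> 'b \<Rightarrow> 'k \<Rightarrow> 'k pmf) \<Rightarrow> ('a \<Rightarrow> 'b \<Rightarrow> 'l \<Rightarrow> 'l pmf) \<Rightarrow>
   nat \<Rightarrow> real \<Rightarrow> 'k pmf \<Rightarrow> ('l \<Rightarrow> real) \<Rightarrow> ('k \<Rightarrow> 'a pmf) \<Rightarrow> ('a \<Rightarrow> 'b \<Rightarrow> 'k pmf) \<Rightarrow>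
   real \<Rightarrow> ('a \<Rightarrow> 'b \<Rightarrow> real) \<Rightarrow> ('a \<Rightarrow> 'b \<Rightarrow> 'l list \<Rightarrow> ('a \<times> 'b) list \<Rightarrow> real) \<Rightarrow>
   ('a \<Rightarrow> 'b \<Rightarrow> 'k list \<Rightarrow> ('a \<times> 'b) list \<Rightarrow> 'a \<Rightarrow> real) \<Rightarrow> ('a \<Rightarrow> 'b \<Rightarrow> 'l \<Rightarrow> real) \<Rightarrow> bool" where
  "lp2_feasible G P Q n lam p \<nu> X pplus \<phi> U0 U R \<alpha> \<longleftrightarrow>
     (\<forall>b l. \<phi> \<le> \<nu> l
        + (\<Sum>k\<in>UNIV. \<Sum>a\<in>UNIV. G k l a b * pmf (X k) a * pmf p k)
        + lam * (\<Sum>k\<in>UNIV. \<Sum>a\<in>UNIV. pmf (X k) a * pmf p k *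
                   (U0 a b - (\<Sum>l'\<in>UNIV. pmf (Q a b l) l' * \<alpha> a b l')))) \<and>
     (\<forall>a b l. \<alpha> a b l + U a b [l] [] \<ge> U0 a b) \<and>
     (\<forall>a b. \<forall>s\<in>{1..n-1}. \<forall>ls hs bs. is_info s ls hs \<longrightarrow>
        (\<Sum>ks | length ks = s. \<Sum>as\<in>UNIV.
           R a b ks hs as * lam ^ (s - 1) * G (last ks) (last ls) as bs)
        + (\<Sum>l'\<in>UNIV. \<Sum>as\<in>UNIV. pmf (Q as bs (last ls)) l' * U a b (ls @ [l']) (hs @ [(as, bs)]))
        \<ge> U a b ls hs) \<and>
     (\<forall>a b. \<forall>t\<in>{2..n-1}. \<forall>ks hs a' b' k'. is_info (t - 1) ks hs \<longrightarrow>
        (\<Sum>ac\<in>UNIV. R a b (ks @ [k']) (hs @ [(a', b')]) ac)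
        = pmf (P a' b' (last ks)) k' * R a b ks hs a') \<and>
     (\<forall>a b k. (\<Sum>a1\<in>UNIV. R a b [k] [] a1) = pmf (pplus a b) k) \<and>
     (\<forall>a b ls hs. is_info n ls hs \<longrightarrow> U a b ls hs = 0) \<and>
     (\<forall>a b. \<forall>t\<in>{1..n-1}. \<forall>ks hs ac. is_info t ks hs \<longrightarrow> R a b ks hs ac \<ge> 0)"

definition lp2_optimal ::
  "('k::finite \<Rightarrow> 'l::finite \<Rightarrow> 'a::finite \<Rightarrow> 'b::finite \<Rightarrow> real) \<Rightarrow>
   ('a \<Rightarrow> 'b \<Rightarrow> 'k \<Rightarrow> 'k pmf) \<Rightarrow> ('a \<Rightarrow> 'b \<Rightarrow> 'l \<Rightarrow> 'l pmf) \<Rightarrow>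
   nat \<Rightarrow> real \<Rightarrow> 'k pmf \<Rightarrow> ('l \<Rightarrow> real) \<Rightarrow> ('k \<Rightarrow> 'a pmf) \<Rightarrow> ('a \<Rightarrow> 'b \<Rightarrow> 'k pmf) \<Rightarrow>
   real \<Rightarrow> ('a \<Rightarrow> 'b \<Rightarrow> real) \<Rightarrow> ('a \<Rightarrow> 'b \<Rightarrow> 'l list \<Rightarrow> ('a \<times> 'b) list \<Rightarrow> real) \<Rightarrow>
   ('a \<Rightarrow> 'b \<Rightarrow> 'k list \<Rightarrow> ('a \<times> 'b) list \<Rightarrow> 'a \<Rightarrow> real) \<Rightarrow> ('a \<Rightarrow> 'b \<Rightarrow> 'l \<Rightarrow> real) \<Rightarrow> bool" where
  "lp2_optimal G P Q n lam p \<nu> X pplus \<phi> U0 U R \<alpha> \<longleftrightarrow>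
     lp2_feasible G P Q n lam p \<nu> X pplus \<phi> U0 U R \<alpha> \<and>
     (\<forall>\<phi>' U0' U' R' \<alpha>'. lp2_feasible G P Q n lam p \<nu> X pplus \<phi>' U0' U' R' \<alpha>' \<longrightarrow> \<phi>' \<le> \<phi>)"


subsection \<open>The problems defining the stage-2 vector payoffs\<close>

text \<open>The argument \<open>qplus\<close> (below \<open>pplus\<close>) is a choice of belief updates for every possible
  stage-1 strategy of the player.  The objectives are linear in \<open>\<pi>\<close> and \<open>\<psi>\<close>, so the
  supremum and the infimum are attained.\<close>

definition vector_objective1 ::
  "('k::finite \<Rightarrow> 'l::finite \<Rightarrow> 'a::finite \<Rightarrow> 'b::finite \<Rightarrow> real) \<Rightarrow>
   ('a \<Rightarrow> 'b \<Rightarrow> 'k \<Rightarrow> 'k pmf) \<Rightarrow> ('a \<Rightarrow> 'b \<Rightarrow> 'l \<Rightarrow> 'l pmf) \<Rightarrow>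
   nat \<Rightarrow> real \<Rightarrow> ('k \<Rightarrow> real) \<Rightarrow> 'l pmf \<Rightarrow> (('l \<Rightarrow> 'b pmf) \<Rightarrow> 'a \<Rightarrow> 'b \<Rightarrow> 'l pmf) \<Rightarrow>
   ('l \<Rightarrow> 'b pmf) \<Rightarrow> ('a \<Rightarrow> 'b \<Rightarrow> 'k \<Rightarrow> real) \<Rightarrow> real" where
  "vector_objective1 G P Q n lam \<mu> q qplus Y \<beta> =
     (SUP \<pi>::('a \<times> 'k) pmf. \<Sum>a\<in>UNIV. \<Sum>k\<in>UNIV. pmf \<pi> (a, k) *
        (\<mu> k + (\<Sum>l\<in>UNIV. \<Sum>b\<in>UNIV. G k l a b * pmf (Y l) b * pmf q l)
         + lam * (\<Sum>b\<in>UNIV. action_prob q Y b *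
                    (w1 G P Q (n - 1) lam (\<beta> a b) (qplus Y a b)
                     - (\<Sum>k'\<in>UNIV. pmf (P a b k) k' * \<beta> a b k')))))"

definition solves_vector_problem1 ::
  "('k::finite \<Rightarrow> 'l::finite \<Rightarrow> 'a::finite \<Rightarrow> 'b::finite \<Rightarrow> real) \<Rightarrow>
   ('a \<Rightarrow> 'b \<Rightarrow> 'k \<Rightarrow> 'k pmf) \<Rightarrow> ('a \<Rightarrow> 'b \<Rightarrow> 'l \<Rightarrow> 'l pmf) \<Rightarrow>
   nat \<Rightarrow> real \<Rightarrow> ('k \<Rightarrow> real) \<Rightarrow> 'l pmf \<Rightarrow> (('l \<Rightarrow> 'b pmf) \<Rightarrow> 'a \<Rightarrow> 'b \<Rightarrow> 'l pmf) \<Rightarrow>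
   ('l \<Rightarrow> 'b pmf) \<Rightarrow> ('a \<Rightarrow> 'b \<Rightarrow> 'k \<Rightarrow> real) \<Rightarrow> bool" where
  "solves_vector_problem1 G P Q n lam \<mu> q qplus Y \<beta> \<longleftrightarrow>
     vector_objective1 G P Q n lam \<mu> q qplus Y \<beta> = w1 G P Q n lam \<mu> q \<and>
     (\<forall>Y' \<beta>'. vector_objective1 G P Q n lam \<mu> q qplus Y \<beta>
            \<le> vector_objective1 G P Q n lam \<mu> q qplus Y' \<beta>')"

definition vector_objective2 ::
  "('k::finite \<Rightarrow> 'l::finite \<Rightarrow> 'a::finite \<Rightarrow> 'b::finite \<Rightarrow> real) \<Rightarrow>
   ('a \<Rightarrow> 'b \<Rightarrow> 'k \<Rightarrow> 'k pmf) \<Rightarrow> ('a \<Rightarrow> 'b \<Rightarrow> 'l \<Rightarrow> 'l pmf) \<Rightarrow>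
   nat \<Rightarrow> real \<Rightarrow> 'k pmf \<Rightarrow> ('l \<Rightarrow> real) \<Rightarrow> (('k \<Rightarrow> 'a pmf) \<Rightarrow> 'a \<Rightarrow> 'b \<Rightarrow> 'k pmf) \<Rightarrow>
   ('k \<Rightarrow> 'a pmf) \<Rightarrow> ('a \<Rightarrow> 'b \<Rightarrow> 'l \<Rightarrow> real) \<Rightarrow> real" where
  "vector_objective2 G P Q n lam p \<nu> pplus X \<alpha> =
     (INF \<psi>::('b \<times> 'l) pmf. \<Sum>b\<in>UNIV. \<Sum>l\<in>UNIV. pmf \<psi> (b, l) *
        (\<nu> l + (\<Sum>k\<in>UNIV. \<Sum>a\<in>UNIV. G k l a b * pmf (X k) a * pmf p k)
         + lam * (\<Sum>a\<in>UNIV. action_prob p X a *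
                    (w2 G P Q (n - 1) lam (pplus X a b) (\<alpha> a b)
                     - (\<Sum>l'\<in>UNIV. pmf (Q a b l) l' * \<alpha> a b l')))))"

definition solves_vector_problem2 ::
  "('k::finite \<Rightarrow> 'l::finite \<Rightarrow> 'a::finite \<Rightarrow> 'b::finite \<Rightarrow> real) \<Rightarrow>
   ('a \<Rightarrow> 'b \<Rightarrow> 'k \<Rightarrow> 'k pmf) \<Rightarrow> ('a \<Rightarrow> 'b \<Rightarrow> 'l \<Rightarrow> 'l pmf) \<Rightarrow>
   nat \<Rightarrow> real \<Rightarrow> 'k pmf \<Rightarrow> ('l \<Rightarrow> real) \<Rightarrow> (('k \<Rightarrow> 'a pmf) \<Rightarrow> 'a \<Rightarrow> 'b \<Rightarrow> 'k pmf) \<Rightarrow>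
   ('k \<Rightarrow> 'a pmf) \<Rightarrow> ('a \<Rightarrow> 'b \<Rightarrow> 'l \<Rightarrow> real) \<Rightarrow> bool" where
  "solves_vector_problem2 G P Q n lam p \<nu> pplus X \<alpha> \<longleftrightarrow>
     vector_objective2 G P Q n lam p \<nu> pplus X \<alpha> = w2 G P Q n lam p \<nu> \<and>
     (\<forall>X' \<alpha>'. vector_objective2 G P Q n lam p \<nu> pplus X' \<alpha>'
            \<le> vector_objective2 G P Q n lam p \<nu> pplus X \<alpha>)"

end

theory Submission
  imports Defs
begin

text \<open>
  Player 2 enters player 1's payoff only through the realization weights \<open>S\<close> of its behaviour
  strategy, linearly, and the weights are exactly the solutions of the flow constraints of the
  linear program; player 1's best reply to \<open>S\<close> is computed by the backward recursion of which the
  variables \<open>Z\<close> are the supersolutions.  Finitely many strategies of player 1 contain a best reply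
  to every \<open>S\<close>, and by perfect recall the payoff functions of behaviour strategies form a convex
  set, so an elementary minimax argument shows that the dual game has a value.

  A feasible point of the program yields continuation strategies guaranteeing \<open>Z0 a b\<close> after
  \<open>(a, b)\<close>, hence bounds the vector objective by \<open>\<rho>\<close>; the vector objective is at least the value,
  because playing \<open>Y\<close> and then nearly optimally in the continuation games guarantees it; and the
  continuations of an optimal strategy give a feasible point with \<open>\<rho>\<close> equal to the value, with
  \<open>Z0 = 0\<close> and \<open>\<beta>\<close> the negative of player 1's best reply values.  Type 2 is type 1 with the players
  exchanged and the payoffs negated.
\<close>

text \<open>The freedom in \<open>\<beta>\<close> is what lets the program reach the value. After
  \<open>(a, b)\<close>, the continuation of an optimal strategy is not known to be optimal for any
  vector payoff fixed beforehand; with \<open>\<beta>\<close> the negative of its best reply values,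
  every next state is worth exactly 0 against it. One bound \<open>Z0 = 0\<close> then serves all
  states, and the term with \<open>P\<close> restores the values that were subtracted. The two
  players are treated asymmetrically. Player 1 has finitely many candidate best replies, so the
  minimax argument is an induction on a finite set and needs no topology. Player 2's infimum is only
  approached, so the inequality between value and vector objective is proved up to an arbitrary
  error; the program itself loses nothing, since an optimal strategy is given. Actions of
  probability 0 leave beliefs and behaviour undetermined. Weights therefore stay unnormalized, with
  the factor \<open>action_prob q Y b\<close> outside, and the zero case is confined to a few
  identities stated with products instead of quotients.\<close>

subsection \<open>A minimax principle\<close>

text \<open>A point with \<open>f y < 0\<close> bounds \<open>t\<close> from above by
  \<open>g y / (g y - f y)\<close>; a point with \<open>g z < 0\<close> bounds it from below by
  \<open>- g z / (f z - g z)\<close>. These bounds never conflict, for otherwise the segment from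
  \<open>y\<close> to \<open>z\<close> would contain a point where both functions are
  negative.\<close>

lemma minimax_two:
  fixes f g :: "'y \<Rightarrow> real"
  assumes C: "\<And>y z t. y \<in> C \<Longrightarrow> z \<in> C \<Longrightarrow> 0 \<le> t \<Longrightarrow> t \<le> 1 \<Longrightarrow>
      \<exists>w\<in>C. f w = t * f y + (1 - t) * f z \<and> g w = t * g y + (1 - t) * g z"
    and fg: "\<And>y. y \<in> C \<Longrightarrow> 0 \<le> f y \<or> 0 \<le> g y"
  shows "\<exists>t. 0 \<le> t \<and> t \<le> 1 \<and> (\<forall>y\<in>C. 0 \<le> t * f y + (1 - t) * g y)"
proof -
  define A where "A = {g y / (g y - f y) |y. y \<in> C \<and> f y < 0}"
  have cross: "g y * f z \<ge> f y * g z" if y: "y \<in> C" "f y < 0" and z: "z \<in> C" "g z < 0" for y z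
  proof (rule ccontr)
    assume neg: "\<not> g y * f z \<ge> f y * g z"
    have gy: "g y \<ge> 0" using fg[OF y(1)] y by auto
    have fz: "f z \<ge> 0" using fg[OF z(1)] z by auto
    define c where "c = g y - f y + (f z - g z)"
    have c: "c > 0" using gy fz y z by (auto simp: c_def)
    \<comment> \<open>On the segment from \<open>y\<close> to \<open>z\<close> this is the point where \<open>f\<close> and \<open>g\<close> agree.\<close>
    define t where "t = (f z - g z) / c"
    have t': "1 - t = (g y - f y) / c" using c by (simp add: t_def diff_divide_distrib [symmetric] divide_eq_eq_1 eq_divide_eq c_def field_simps)
    have "0 \<le> t" "0 \<le> 1 - t" using gy fz y z c unfolding t' by (auto simp: t_def)
    then have t: "0 \<le> t" "t \<le> 1" by auto
    obtain w where w: "w \<in> C" "f w = t * f y + (1 - t) * f z" "g w = t * g y + (1 - t) * g z"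
      using C[OF y(1) z(1) t] by blast
    have "f w = (g y * f z - f y * g z) / c" "g w = (g y * f z - f y * g z) / c"
      unfolding w t' unfolding t_def using c by (simp_all add: field_simps)
    then have "f w < 0" "g w < 0" using neg c by (auto simp: divide_neg_pos)
    then show False using fg[OF w(1)] by auto
  qed
  \<comment> \<open>The largest admissible \<open>t\<close>. Without upper bounds it is set to 1,
    because \<open>Inf {}\<close> is unspecified for reals.\<close>
  define t where "t = (if A = {} then 1 else Inf A)"
  have A0: "0 \<le> x" if x: "x \<in> A" for x
  proof -
    obtain y where y: "y \<in> C" "f y < 0" "x = g y / (g y - f y)" using x by (auto simp: A_def)
    then have "0 \<le> g y" using fg[of y] by auto
    then show ?thesis using y by simp
  qed
  have bdd: "bdd_below A" using A0 by (rule bdd_belowI)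
  have "t \<ge> 0"
  proof (cases "A = {}")
    case False
    then have "Inf A \<ge> 0" using A0 by (rule cInf_greatest)
    then show ?thesis by (simp add: t_def)
  qed (simp add: t_def)
  moreover have "t \<le> 1"
  proof (cases "A = {}")
    case False
    then obtain y where y: "y \<in> C" "f y < 0" by (auto simp: A_def)
    then have "g y \<ge> 0" using fg[of y] by auto
    then have "g y / (g y - f y) \<le> 1" using y by simp
    moreover have "Inf A \<le> g y / (g y - f y)" by (rule cInf_lower[OF _ bdd]) (use y in \<open>auto simp: A_def\<close>)
    ultimately show ?thesis by (simp add: t_def)
  qed (simp add: t_def)
  moreover have "0 \<le> t * f y + (1 - t) * g y" if y: "y \<in> C" for y
  proof -
    consider "f y < 0" | "g y < 0" "f y \<ge> 0" | "f y \<ge> 0" "g y \<ge> 0" by linarith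
    then show ?thesis
    proof cases
      case 1
      then have gy: "g y \<ge> 0" using fg[OF y] by auto
      have "g y / (g y - f y) \<in> A" using 1 y by (auto simp: A_def)
      then have "t \<le> g y / (g y - f y)" using cInf_lower[OF _ bdd] by (auto simp: t_def)
      then show ?thesis using 1 gy by (simp add: field_simps)
    next
      case 2
      have "- g y / (f y - g y) \<le> t"
      proof (cases "A = {}")
        case False
        have "- g y / (f y - g y) \<le> x" if x: "x \<in> A" for x
        proof -
          obtain z where z: "z \<in> C" "f z < 0" "x = g z / (g z - f z)" using x by (auto simp: A_def)
          have gz: "g z \<ge> 0" using fg[OF z(1)] z by auto
          have "g z * f y \<ge> f z * g y" using cross z y 2 by blast
          then have "- g y * (g z - f z) \<le> g z * (f y - g y)" by (simp add: algebra_simps)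
          moreover have "f y - g y > 0" "g z - f z > 0" using 2 z gz by auto
          ultimately show ?thesis
            unfolding z(3) by (metis pos_divide_le_eq pos_le_divide_eq times_divide_eq_left)
        qed
        then show ?thesis using False by (simp add: t_def cInf_greatest)
      qed (use 2 in \<open>auto simp: t_def divide_simps\<close>)
      then have "- g y \<le> t * (f y - g y)" using 2 by (simp add: divide_simps)
      then show ?thesis by (simp add: algebra_simps)
    next
      case 3
      then show ?thesis using \<open>0 \<le> t\<close> \<open>t \<le> 1\<close> by simp
    qed
  qed
  ultimately show ?thesis by blast
qed

text \<open>Induction on \<open>F\<close> with the convex set \<open>C\<close> varying: on the
  points where the new \<open>f\<close> is negative, the remaining functions suffice and yield one
  \<open>g\<close>; then \<open>f\<close> and \<open>g\<close> are combined on all of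
  \<open>C\<close>. Convexity of \<open>C\<close> is expressed through the values of functions in
  \<open>D\<close>, since strategies have no vector space structure of their own.\<close>

lemma minimax:
  fixes D :: "('y \<Rightarrow> real) set"
  assumes D: "\<And>f g t. f \<in> D \<Longrightarrow> g \<in> D \<Longrightarrow> 0 \<le> t \<Longrightarrow> t \<le> 1 \<Longrightarrow> (\<lambda>y. t * f y + (1 - t) * g y) \<in> D"
    and C: "\<And>y z t. y \<in> C \<Longrightarrow> z \<in> C \<Longrightarrow> 0 \<le> t \<Longrightarrow> t \<le> 1 \<Longrightarrow>
      \<exists>w\<in>C. \<forall>f\<in>D. f w = t * f y + (1 - t) * f z"
    and F: "finite F" "F \<noteq> {}" "F \<subseteq> D" "\<And>y. y \<in> C \<Longrightarrow> \<exists>f\<in>F. 0 \<le> f y"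
  shows "\<exists>f\<in>D. \<forall>y\<in>C. 0 \<le> f y"
  using F C
proof (induction F arbitrary: C rule: finite_ne_induct)
  case (singleton f)
  then show ?case by auto
next
  case (insert f F)
  define C' where "C' = {y\<in>C. f y < 0}"
  have f: "f \<in> D" using insert.prems by auto
  have "\<exists>g\<in>D. \<forall>y\<in>C'. 0 \<le> g y"
  proof (rule insert.IH)
    show "\<exists>f\<in>F. 0 \<le> f y" if "y \<in> C'" for y
      using insert.prems(2)[of y] that by (auto simp: C'_def)
    fix y z and t :: real
    assume *: "y \<in> C'" "z \<in> C'" "0 \<le> t" "t \<le> 1"
    then obtain w where w: "w \<in> C" "\<forall>f\<in>D. f w = t * f y + (1 - t) * f z"
      using insert.prems(3)[of y z t] by (auto simp: C'_def)
    have "t * f y + (1 - t) * f z < 0"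
      using * convex_bound_lt[of "f y" 0 "f z" t "1 - t"] by (auto simp: C'_def)
    then show "\<exists>w\<in>C'. \<forall>f\<in>D. f w = t * f y + (1 - t) * f z"
      using w f by (intro bexI[of _ w]) (auto simp: C'_def)
  qed (use insert.prems in auto)
  then obtain g where g: "g \<in> D" "\<forall>y\<in>C'. 0 \<le> g y" by blast
  have "\<exists>t. 0 \<le> t \<and> t \<le> 1 \<and> (\<forall>y\<in>C. 0 \<le> t * f y + (1 - t) * g y)"
  proof (rule minimax_two)
    show "\<exists>w\<in>C. f w = t * f y + (1 - t) * f z \<and> g w = t * g y + (1 - t) * g z"
      if "y \<in> C" "z \<in> C" "0 \<le> t" "t \<le> 1" for y z t
      using insert.prems(3)[OF that] f g(1) by blast
    show "0 \<le> f y \<or> 0 \<le> g y" if "y \<in> C" for y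
      using g(2) that not_le_imp_less unfolding C'_def by blast
  qed
  then obtain t where t: "0 \<le> t" "t \<le> 1" "\<forall>y\<in>C. 0 \<le> t * f y + (1 - t) * g y" by blast
  show ?case using t(3) by (intro bexI[OF _ D[OF f g(1) t(1,2)]])
qed


section \<open>The value of a bounded zero-sum game\<close>

definition has_value :: "('s \<Rightarrow> 't \<Rightarrow> real) \<Rightarrow> real \<Rightarrow> bool" where
  "has_value f v \<longleftrightarrow> (SUP s. INF t. f s t) = v \<and> (INF t. SUP s. f s t) = v"

lemma game_value_eqI: "has_value f v \<Longrightarrow> game_value f = v"
  unfolding game_value_def has_value_def by (rule the_equality) auto

text \<open>Weak duality gives one inequality. For the other, \<open>guarantee\<close> is applied to
  the upper value itself, so only the maximizer has to attain it.\<close>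

lemma has_valueI:
  fixes f :: "'s \<Rightarrow> 't \<Rightarrow> real"
  assumes bounded: "\<And>s t. \<bar>f s t\<bar> \<le> B"
    and guarantee: "\<And>v. (\<And>t. v \<le> (SUP s. f s t)) \<Longrightarrow> \<exists>s. \<forall>t. v \<le> f s t"
  shows "has_value f (INF t. SUP s. f s t)"
proof -
  have b: "- B \<le> f s t" "f s t \<le> B" for s t using bounded[of s t] by auto
  have bdd: "bdd_above (range (\<lambda>s. f s t))" "bdd_below (range (f s))" for s t
    by (rule bdd_aboveI2[of _ _ B], rule b, rule bdd_belowI2[of _ "- B"], rule b)
  have le_SUP: "f s t \<le> (SUP s. f s t)" for s t by (rule cSUP_upper) (auto simp: bdd)
  have INF_le: "(INF t. f s t) \<le> f s t" for s t by (rule cINF_lower) (auto simp: bdd)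
  have bdd': "bdd_below (range (\<lambda>t. SUP s. f s t))"
    using b(1) le_SUP by (intro bdd_belowI2[of _ "- B"]) (meson order_trans)
  have bdd'': "bdd_above (range (\<lambda>s. INF t. f s t))"
    using b(2) INF_le by (intro bdd_aboveI2[of _ _ B]) (meson order_trans)
  have "(INF t. SUP s. f s t) \<le> (SUP s. f s t)" for t by (rule cINF_lower) (auto simp: bdd')
  then obtain s where "\<forall>t. (INF t. SUP s. f s t) \<le> f s t" using guarantee by blast
  then have "(INF t. SUP s. f s t) \<le> (INF t. f s t)" by (intro cINF_greatest) auto
  also have "\<dots> \<le> (SUP s. INF t. f s t)" by (rule cSUP_upper) (auto simp: bdd'')
  finally have "(INF t. SUP s. f s t) \<le> (SUP s. INF t. f s t)" .
  moreover have "(SUP s. INF t. f s t) \<le> (INF t. SUP s. f s t)"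
    by (intro cSUP_least cINF_greatest order_trans[OF INF_le le_SUP]) auto
  ultimately show ?thesis by (simp add: has_value_def)
qed


subsection \<open>Weighted sums\<close>

lemma pmf_weighted_le:
  fixes f :: "'x::finite \<Rightarrow> real"
  assumes "\<And>x. f x \<le> c"
  shows "(\<Sum>x\<in>UNIV. pmf p x * f x) \<le> c"
proof -
  have "(\<Sum>x\<in>UNIV. pmf p x * f x) \<le> (\<Sum>x\<in>UNIV. pmf p x * c)"
    by (intro sum_mono mult_left_mono) (use assms in auto)
  then show ?thesis by (simp flip: sum_distrib_right add: sum_pmf_eq_1)
qed

lemma pmf_weighted_return:
  fixes f :: "'x::finite \<Rightarrow> real"
  shows "(\<Sum>x\<in>UNIV. pmf (return_pmf y) x * f x) = f y"
proof -
  have "(\<Sum>x\<in>UNIV. pmf (return_pmf y) x * f x) = (\<Sum>x\<in>UNIV. if x = y then f x else 0)"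
    by (rule sum.cong) (auto simp: indicator_def)
  then show ?thesis by simp
qed

lemma pmf_weighted_pair_le:
  fixes M :: "'x::finite \<Rightarrow> 'y::finite \<Rightarrow> real"
  assumes "\<And>x y. M x y \<le> c"
  shows "(\<Sum>x\<in>UNIV. \<Sum>y\<in>UNIV. pmf \<pi> (x, y) * M x y) \<le> c"
  using pmf_weighted_le[of "\<lambda>(x, y). M x y" c \<pi>] assms
  by (simp add: sum.cartesian_product split_def)

lemma pmf_weighted_pair_return:
  fixes M :: "'x::finite \<Rightarrow> 'y::finite \<Rightarrow> real"
  shows "(\<Sum>x\<in>UNIV. \<Sum>y\<in>UNIV. pmf (return_pmf (x', y')) (x, y) * M x y) = M x' y'"
  using pmf_weighted_return[of "(x', y')" "\<lambda>(x, y). M x y"]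
  by (simp only: sum.cartesian_product split_def UNIV_Times_UNIV prod.collapse fst_conv snd_conv)

text \<open>A linear function on a simplex is bounded by its values at the vertices, here the point
  masses. This turns the inner maximum of the vector problem into one inequality per pair, as in the
  linear program.\<close>

lemma SUP_pmf_pair_le_iff:
  fixes M :: "'x::finite \<Rightarrow> 'y::finite \<Rightarrow> real"
  shows "(SUP \<pi>. \<Sum>x\<in>UNIV. \<Sum>y\<in>UNIV. pmf \<pi> (x, y) * M x y) \<le> c \<longleftrightarrow> (\<forall>x y. M x y \<le> c)"
proof (intro iffI allI)
  fix x y
  assume le: "(SUP \<pi>. \<Sum>x\<in>UNIV. \<Sum>y\<in>UNIV. pmf \<pi> (x, y) * M x y) \<le> c"
  define B where "B = (MAX (x, y). M x y)"
  have "M x y \<le> B" for x y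
    unfolding B_def by (rule Max_ge) (auto intro: range_eqI[of _ _ "(x, y)"])
  then have "bdd_above (range (\<lambda>\<pi>. \<Sum>x\<in>UNIV. \<Sum>y\<in>UNIV. pmf \<pi> (x, y) * M x y))"
    by (intro bdd_aboveI2[of _ _ B] pmf_weighted_pair_le)
  then have "(\<Sum>x'\<in>UNIV. \<Sum>y'\<in>UNIV. pmf (return_pmf (x, y)) (x', y') * M x' y') \<le>
      (SUP \<pi>. \<Sum>x\<in>UNIV. \<Sum>y\<in>UNIV. pmf \<pi> (x, y) * M x y)"
    by (intro cSUP_upper) auto
  then show "M x y \<le> c" using le unfolding pmf_weighted_pair_return by linarith
next
  assume "\<forall>x y. M x y \<le> c"
  then show "(SUP \<pi>. \<Sum>x\<in>UNIV. \<Sum>y\<in>UNIV. pmf \<pi> (x, y) * M x y) \<le> c"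
    by (intro cSUP_least pmf_weighted_pair_le) auto
qed

section \<open>Mixing and normalizing distributions\<close>

lemma ex_mix_pmf:
  fixes x y :: "'c pmf"
  assumes "0 \<le> t" "t \<le> 1"
  shows "\<exists>z. \<forall>c. pmf z c = t * pmf x c + (1 - t) * pmf y c"
proof -
  have "pmf (bernoulli_pmf t \<bind> (\<lambda>b. if b then x else y)) c = t * pmf x c + (1 - t) * pmf y c" for c
    using assms by (simp add: pmf_bind)
  then show ?thesis by blast
qed

text \<open>The product form covers a total of 0 as well: then \<open>f\<close> vanishes and any
  distribution will do.\<close>

lemma ex_pmf_proportional:
  fixes f :: "'c::finite \<Rightarrow> real"
  assumes "\<And>c. 0 \<le> f c"
  shows "\<exists>x. \<forall>c. f c = sum f UNIV * pmf x c"
proof (cases "sum f UNIV = 0")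
  case True
  then show ?thesis using assms by (simp add: sum_nonneg_eq_0_iff)
next
  case False
  then have pos: "sum f UNIV > 0" using assms by (simp add: sum_nonneg less_le)
  define x where "x = embed_pmf (\<lambda>c. f c / sum f UNIV)"
  have "pmf x c = f c / sum f UNIV" for c
    unfolding x_def
  proof (rule pmf_embed_pmf)
    have "(\<Sum>c\<in>UNIV. f c / sum f UNIV) = 1" using pos by (simp flip: sum_divide_distrib)
    then show "(\<integral>\<^sup>+ c. ennreal (f c / sum f UNIV) \<partial>count_space UNIV) = 1"
      using assms pos by (simp add: nn_integral_count_space_finite sum_ennreal)
  qed (use assms pos in auto)
  then have "\<forall>c. f c = sum f UNIV * pmf x c" using pos by simp
  then show ?thesis by blast
qed

text \<open>Bayes' rule: if a mixture with weights \<open>t\<close> and \<open>1 - t\<close>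
  produces an outcome with likelihoods \<open>x\<close> and \<open>y\<close>, then \<open>u\<close>
  is the posterior weight of the first component. It is chosen before \<open>f\<close> and
  \<open>g\<close>, so one posterior serves all continuation payoffs.\<close>

lemma mixture_weights:
  fixes x y t :: real
  assumes "0 \<le> t" "t \<le> 1" "0 \<le> x" "0 \<le> y"
  obtains u where "0 \<le> u" "u \<le> 1"
    "\<And>f g. t * (x * f) + (1 - t) * (y * g) = (t * x + (1 - t) * y) * (u * f + (1 - u) * g)"
proof -
  define z where "z = t * x + (1 - t) * y"
  have nn: "0 \<le> t * x" "0 \<le> (1 - t) * y" using assms by auto
  show ?thesis
  proof (cases "z = 0")
    case True
    then have "t * x = 0" "(1 - t) * y = 0" using nn unfolding z_def by linarith+
    then show ?thesis by (intro that[of 0]) auto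
  next
    case False
    then have "z > 0" using nn by (auto simp: z_def less_le)
    show ?thesis
    proof (rule that[of "t * x / z"])
      show "t * x / z \<le> 1" using nn \<open>z > 0\<close> by (simp add: z_def)
      fix f g
      have "z - t * x = (1 - t) * y" by (simp add: z_def)
      then have "z * g - t * x * g = (1 - t) * y * g" by (metis left_diff_distrib)
      then have "z * (t * x / z * f + (1 - t * x / z) * g) = t * x * f + (1 - t) * y * g"
        using \<open>z > 0\<close> by (simp add: distrib_left right_diff_distrib left_diff_distrib mult.assoc)
      then show "t * (x * f) + (1 - t) * (y * g) =
          (t * x + (1 - t) * y) * (t * x / z * f + (1 - t * x / z) * g)"
        unfolding z_def[symmetric] by (simp add: mult.assoc)
    qed (use nn \<open>z > 0\<close> in auto)
  qed
qed

section \<open>Reindexing sums over histories\<close>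

lemma sum_swap3:
  "(\<Sum>x\<in>A. \<Sum>y\<in>B. \<Sum>z\<in>C. f x y z) = (\<Sum>z\<in>C. \<Sum>y\<in>B. \<Sum>x\<in>A. f x y z)"
proof -
  have "(\<Sum>x\<in>A. \<Sum>y\<in>B. \<Sum>z\<in>C. f x y z) = (\<Sum>x\<in>A. \<Sum>z\<in>C. \<Sum>y\<in>B. f x y z)"
    by (rule sum.cong[OF refl]) (rule sum.swap)
  also have "\<dots> = (\<Sum>z\<in>C. \<Sum>x\<in>A. \<Sum>y\<in>B. f x y z)" by (rule sum.swap)
  also have "\<dots> = (\<Sum>z\<in>C. \<Sum>y\<in>B. \<Sum>x\<in>A. f x y z)"
    by (rule sum.cong[OF refl]) (rule sum.swap)
  finally show ?thesis .
qed

lemma sum_lists_Cons: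
  fixes f :: "'x::finite list \<Rightarrow> 'c::comm_monoid_add"
  shows "(\<Sum>xs | length xs = Suc s. f xs) = (\<Sum>xs | length xs = s. \<Sum>x\<in>UNIV. f (x # xs))"
proof -
  have "(\<Sum>xs | length xs = s. \<Sum>x\<in>UNIV. f (x # xs)) =
      (\<Sum>(xs, x)\<in>{xs. length xs = s} \<times> UNIV. f (x # xs))"
    using finite_lists_length_eq[of "UNIV :: 'x set" s] by (simp add: sum.cartesian_product)
  also have "\<dots> = (\<Sum>xs | length xs = Suc s. f xs)"
  proof (rule sum.reindex_bij_witness[of _ "\<lambda>xs. (tl xs, hd xs)" "\<lambda>(xs, x). x # xs"])
    fix xs :: "'x list" assume "xs \<in> {xs. length xs = Suc s}"
    then show "(\<lambda>(xs, x). x # xs) (tl xs, hd xs) = xs" "(tl xs, hd xs) \<in> {xs. length xs = s} \<times> UNIV"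
      by (cases xs; simp)+
  qed auto
  finally show ?thesis by simp
qed

lemma sum_lists_snoc:
  fixes f :: "'x::finite list \<Rightarrow> 'c::comm_monoid_add"
  shows "(\<Sum>xs | length xs = Suc s. f xs) = (\<Sum>xs | length xs = s. \<Sum>x\<in>UNIV. f (xs @ [x]))"
proof -
  have "(\<Sum>xs | length xs = s. \<Sum>x\<in>UNIV. f (xs @ [x])) =
      (\<Sum>(xs, x)\<in>{xs. length xs = s} \<times> UNIV. f (xs @ [x]))"
    using finite_lists_length_eq[of "UNIV :: 'x set" s] by (simp add: sum.cartesian_product)
  also have "\<dots> = (\<Sum>xs | length xs = Suc s. f xs)"
  proof (rule sum.reindex_bij_witness[of _ "\<lambda>xs. (butlast xs, last xs)" "\<lambda>(xs, x). xs @ [x]"])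
    fix xs :: "'x list" assume "xs \<in> {xs. length xs = Suc s}"
    then show "(\<lambda>(xs, x). xs @ [x]) (butlast xs, last xs) = xs"
        "(butlast xs, last xs) \<in> {xs. length xs = s} \<times> UNIV"
      by (cases xs rule: rev_cases; simp)+
  qed auto
  finally show ?thesis by simp
qed

lemma sum_lists_one:
  fixes f :: "'x::finite list \<Rightarrow> 'c::comm_monoid_add"
  shows "(\<Sum>xs | length xs = Suc 0. f xs) = (\<Sum>x\<in>UNIV. f [x])"
  by (simp add: sum_lists_Cons)

section \<open>Support of plays\<close>

lemma finite_set_stage:
  fixes P :: "'a::finite \<Rightarrow> 'b::finite \<Rightarrow> 'k::finite \<Rightarrow> 'k pmf"
    and Q :: "'a \<Rightarrow> 'b \<Rightarrow> 'l::finite \<Rightarrow> 'l pmf"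
  shows "finite (set_pmf (stage P Q \<sigma> \<tau> h))"
  unfolding stage_def by (cases h) (simp add: set_bind_pmf)

lemma finite_set_play:
  fixes P :: "'a::finite \<Rightarrow> 'b::finite \<Rightarrow> 'k::finite \<Rightarrow> 'k pmf"
    and Q :: "'a \<Rightarrow> 'b \<Rightarrow> 'l::finite \<Rightarrow> 'l pmf"
  shows "finite (set_pmf (play P Q p q \<sigma> \<tau> t))"
  by (induction t) (auto simp: set_bind_pmf finite_set_stage)

lemma length_play:
  "(ks, ls, hs) \<in> set_pmf (play P Q p q \<sigma> \<tau> t) \<Longrightarrow>
    length ks = Suc t \<and> length ls = Suc t \<and> length hs = t"
proof (induction t arbitrary: ks ls hs)
  case 0
  then show ?case by (auto simp: set_bind_pmf)
next
  case (Suc t)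
  then show ?case by (fastforce simp: set_bind_pmf stage_def)
qed

text \<open>A locale, so that type 2 can be obtained by interpreting it for the game with the
  players exchanged and the payoffs negated.\<close>

locale game =
  fixes G :: "'k::finite \<Rightarrow> 'l::finite \<Rightarrow> 'a::finite \<Rightarrow> 'b::finite \<Rightarrow> real"
    and P :: "'a \<Rightarrow> 'b \<Rightarrow> 'k \<Rightarrow> 'k pmf"
    and Q :: "'a \<Rightarrow> 'b \<Rightarrow> 'l \<Rightarrow> 'l pmf"
    and lam :: real
  assumes lam_nonneg: "0 \<le> lam"
begin

subsection \<open>Realization weights of player 2\<close>

text \<open>Player 2's and its states' share of the probability of a history; the factors of player
  1 and \<open>P\<close> are left out. The initial weights \<open>r\<close> need not sum to 1,
  because after stage 1 they are a belief multiplied by an action probability.\<close>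

definition reach :: "('l \<Rightarrow> real) \<Rightarrow> ('l, 'a, 'b, 'b) strategy \<Rightarrow> 'l list \<Rightarrow> ('a \<times> 'b) list \<Rightarrow> real" where
  "reach r \<tau> ls hs = r (ls ! 0) * (\<Prod>i<length hs.
     pmf (\<tau> (take (Suc i) ls) (take i hs)) (snd (hs ! i)) *
     pmf (Q (fst (hs ! i)) (snd (hs ! i)) (ls ! i)) (ls ! Suc i))"

definition weights ::
  "('l \<Rightarrow> real) \<Rightarrow> ('l, 'a, 'b, 'b) strategy \<Rightarrow> 'l list \<Rightarrow> ('a \<times> 'b) list \<Rightarrow> 'b \<Rightarrow> real" where
  "weights r \<tau> ls hs b = reach r \<tau> ls hs * pmf (\<tau> ls hs) b"

text \<open>The sequence-form polytope: exactly the constraints that the program puts on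
  \<open>S a b\<close>, with \<open>r\<close> the belief \<open>pmf (qplus a b)\<close> and
  \<open>N = n - 1\<close>.\<close>

definition plan ::
  "('l \<Rightarrow> real) \<Rightarrow> nat \<Rightarrow> ('l list \<Rightarrow> ('a \<times> 'b) list \<Rightarrow> 'b \<Rightarrow> real) \<Rightarrow> bool" where
  "plan r N S \<longleftrightarrow>
     (\<forall>l. (\<Sum>b\<in>UNIV. S [l] [] b) = r l) \<and>
     (\<forall>t\<in>{2..N}. \<forall>ls hs a' b' l'. is_info (t - 1) ls hs \<longrightarrow>
        (\<Sum>b\<in>UNIV. S (ls @ [l']) (hs @ [(a', b')]) b) = pmf (Q a' b' (last ls)) l' * S ls hs b') \<and>
     (\<forall>t\<in>{1..N}. \<forall>ls hs b. is_info t ls hs \<longrightarrow> 0 \<le> S ls hs b)"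

lemma reach_Nil [simp]: "reach r \<tau> [l] [] = r l"
  by (simp add: reach_def)

lemma reach_snoc:
  assumes "length ls = Suc (length hs)"
  shows "reach r \<tau> (ls @ [l']) (hs @ [(a, b)]) = weights r \<tau> ls hs b * pmf (Q a b (last ls)) l'"
proof -
  have "ls \<noteq> []" using assms by auto
  then have "last ls = ls ! length hs" using assms by (simp add: last_conv_nth)
  then show ?thesis
    using assms unfolding reach_def weights_def
    by (simp add: nth_append mult.assoc)
qed

lemma info_induct [consumes 1, case_names Nil snoc]:
  assumes "length ss = Suc (length hs)"
    and "\<And>s. R [s] []"
    and "\<And>ss hs a b s'. length ss = Suc (length hs) \<Longrightarrow> R ss hs \<Longrightarrow> R (ss @ [s']) (hs @ [(a, b)])"
  shows "R ss hs"
  using assms(1)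
proof (induction hs arbitrary: ss rule: rev_induct)
  case Nil
  then obtain s where "ss = [s]" by (auto simp: length_Suc_conv)
  then show ?case using assms(2) by simp
next
  case (snoc h hs)
  then obtain ss' s' where ss: "ss = ss' @ [s']" by (cases ss rule: rev_cases) auto
  obtain a b where h: "h = (a, b)" by (cases h)
  have "length ss' = Suc (length hs)" using snoc.prems ss by simp
  then show ?case using assms(3) snoc.IH ss h by blast
qed

lemma reach_nonneg: "(\<And>l. 0 \<le> r l) \<Longrightarrow> 0 \<le> reach r \<tau> ls hs"
  unfolding reach_def by (intro mult_nonneg_nonneg prod_nonneg) auto

lemma weights_nonneg: "(\<And>l. 0 \<le> r l) \<Longrightarrow> 0 \<le> weights r \<tau> ls hs b"
  unfolding weights_def by (intro mult_nonneg_nonneg reach_nonneg) auto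

lemma sum_weights: "(\<Sum>b\<in>UNIV. weights r \<tau> ls hs b) = reach r \<tau> ls hs"
  by (simp add: weights_def sum_pmf_eq_1 flip: sum_distrib_left)

lemma weights_scale: "weights (\<lambda>l. c * r l) \<tau> ls hs b = c * weights r \<tau> ls hs b"
  by (simp add: weights_def reach_def)

lemma plan_weights: "(\<And>l. 0 \<le> r l) \<Longrightarrow> plan r N (weights r \<tau>)"
  unfolding plan_def
  by (auto simp: sum_weights reach_snoc is_info_def weights_nonneg)

text \<open>Normalizing \<open>S\<close> at every history gives a behaviour strategy; the flow
  constraints then show inductively that the total weight at a history is its \<open>reach\<close>.
  Nothing is claimed beyond length \<open>N\<close>.\<close>

lemma plan_realized:
  assumes "plan r N S"
  obtains \<tau> where "\<And>s ls hs b. is_info s ls hs \<Longrightarrow> s \<le> N \<Longrightarrow> S ls hs b = weights r \<tau> ls hs b"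
proof -
  have nonneg: "0 \<le> S ls hs b" if "length ls = Suc (length hs)" "length ls \<le> N" for ls hs b
  proof -
    have "length ls \<in> {1..N}" using that by auto
    then show ?thesis using assms that unfolding plan_def is_info_def by metis
  qed
  have flow: "(\<Sum>b\<in>UNIV. S (ls @ [l']) (hs @ [(a', b')]) b) = pmf (Q a' b' (last ls)) l' * S ls hs b'"
    if "length ls = Suc (length hs)" "length ls < N" for ls hs l' a' b'
  proof -
    have "Suc (length ls) \<in> {2..N}" using that by auto
    then show ?thesis using assms that unfolding plan_def is_info_def by (metis diff_Suc_1)
  qed
  have init: "(\<Sum>b\<in>UNIV. S [l] [] b) = r l" for l using assms by (simp add: plan_def)
  \<comment> \<open>The conditions stand inside the existential so that the choice yields a total
    strategy, arbitrary at histories outside the range.\<close>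
  have "\<exists>x. length ls = Suc (length hs) \<and> length ls \<le> N \<longrightarrow>
      (\<forall>b. S ls hs b = sum (S ls hs) UNIV * pmf x b)" for ls hs
    using ex_pmf_proportional[of "S ls hs"] nonneg[of ls hs] by blast
  then obtain \<tau> where \<tau>: "\<And>ls hs b. length ls = Suc (length hs) \<Longrightarrow> length ls \<le> N \<Longrightarrow>
      S ls hs b = sum (S ls hs) UNIV * pmf (\<tau> ls hs) b"
    by metis
  have "length ls \<le> N \<Longrightarrow> S ls hs b = weights r \<tau> ls hs b" if "length ls = Suc (length hs)" for ls hs b
    using that
  proof (induction arbitrary: b rule: info_induct)
    case (Nil l)
    then show ?case using \<tau>[of "[l]" "[]" b] by (simp add: init weights_def)
  next
    case (snoc ls hs a' b' l')
    have "sum (S (ls @ [l']) (hs @ [(a', b')])) UNIV = reach r \<tau> (ls @ [l']) (hs @ [(a', b')])"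
      using flow[of ls hs l' a' b'] snoc by (simp add: reach_snoc)
    then show ?case
      using \<tau>[of "ls @ [l']" "hs @ [(a', b')]" b] snoc by (simp add: weights_def)
  qed
  then show ?thesis by (intro that[of \<tau>]) (auto simp: is_info_def)
qed


subsection \<open>Payoffs as functions of the realization weights\<close>

text \<open>The first sum in the program's constraint on \<open>Z\<close>, where
  \<open>s - 1 = length hs\<close>. It is an unnormalized expectation, since \<open>S\<close>
  already contains the probabilities of player 2's states and actions.\<close>

definition stage_cost ::
  "('l list \<Rightarrow> ('a \<times> 'b) list \<Rightarrow> 'b \<Rightarrow> real) \<Rightarrow> 'k list \<Rightarrow> ('a \<times> 'b) list \<Rightarrow> 'a \<Rightarrow> real" where
  "stage_cost S ks hs a = (\<Sum>ls | length ls = Suc (length hs). \<Sum>b\<in>UNIV.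
     S ls hs b * lam ^ length hs * G (last ks) (last ls) a b)"

text \<open>The sum over \<open>b\<close> carries no probability of \<open>b\<close>: its likelihood
  is contained in \<open>S\<close> at the longer histories. Hence the payoff is linear in
  \<open>S\<close>.\<close>

primrec follow ::
  "('k, 'a, 'b, 'a) strategy \<Rightarrow> ('l list \<Rightarrow> ('a \<times> 'b) list \<Rightarrow> 'b \<Rightarrow> real) \<Rightarrow>
   nat \<Rightarrow> 'k list \<Rightarrow> ('a \<times> 'b) list \<Rightarrow> real" where
  "follow \<sigma> S 0 ks hs = 0"
| "follow \<sigma> S (Suc m) ks hs = (\<Sum>a\<in>UNIV. pmf (\<sigma> ks hs) a * (stage_cost S ks hs a +
     (\<Sum>k'\<in>UNIV. \<Sum>b\<in>UNIV. pmf (P a b (last ks)) k' * follow \<sigma> S m (ks @ [k']) (hs @ [(a, b)]))))"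

text \<open>The tight solution of the program's constraints on \<open>Z\<close> for given
  \<open>S\<close>: each \<open>Z\<close> is as small as they allow.\<close>

primrec best ::
  "('l list \<Rightarrow> ('a \<times> 'b) list \<Rightarrow> 'b \<Rightarrow> real) \<Rightarrow> nat \<Rightarrow> 'k list \<Rightarrow> ('a \<times> 'b) list \<Rightarrow> real" where
  "best S 0 ks hs = 0"
| "best S (Suc m) ks hs = (MAX a. stage_cost S ks hs a +
     (\<Sum>k'\<in>UNIV. \<Sum>b\<in>UNIV. pmf (P a b (last ks)) k' * best S m (ks @ [k']) (hs @ [(a, b)])))"

text \<open>The continuation payoff conditional on both private histories, a bridge between the
  forward recursion \<open>play\<close> and the backward recursion \<open>follow\<close>.\<close>

primrec cont_payoff ::
  "('k, 'a, 'b, 'a) strategy \<Rightarrow> ('l, 'a, 'b, 'b) strategy \<Rightarrow>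
   nat \<Rightarrow> 'k list \<Rightarrow> 'l list \<Rightarrow> ('a \<times> 'b) list \<Rightarrow> real" where
  "cont_payoff \<sigma> \<tau> 0 ks ls hs = 0"
| "cont_payoff \<sigma> \<tau> (Suc m) ks ls hs = (\<Sum>a\<in>UNIV. pmf (\<sigma> ks hs) a * (\<Sum>b\<in>UNIV. pmf (\<tau> ls hs) b *
     (lam ^ length hs * G (last ks) (last ls) a b +
      (\<Sum>k'\<in>UNIV. pmf (P a b (last ks)) k' * (\<Sum>l'\<in>UNIV. pmf (Q a b (last ls)) l' *
         cont_payoff \<sigma> \<tau> m (ks @ [k']) (ls @ [l']) (hs @ [(a, b)]))))))"

section \<open>From expectations over plays to realization weights\<close>

lemma expectation_bind_finite:
  assumes "\<And>x. finite (set_pmf (f x))"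
  shows "measure_pmf.expectation (p \<bind> f) (g :: _ \<Rightarrow> real) =
    (\<Sum>x\<in>UNIV. pmf (p :: 'x::finite pmf) x * measure_pmf.expectation (f x) g)"
  by (subst pmf_expectation_bind[of UNIV]) (use assms in auto)

lemma expectation_stage:
  "measure_pmf.expectation (stage P Q \<sigma> \<tau> (ks, ls, hs)) \<phi> =
   (\<Sum>a\<in>UNIV. pmf (\<sigma> ks hs) a * (\<Sum>b\<in>UNIV. pmf (\<tau> ls hs) b *
     (\<Sum>k'\<in>UNIV. pmf (P a b (last ks)) k' * (\<Sum>l'\<in>UNIV. pmf (Q a b (last ls)) l' *
        (\<phi> (ks @ [k'], ls @ [l'], hs @ [(a, b)]) :: real)))))"
  unfolding stage_def by (simp add: expectation_bind_finite set_bind_pmf)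

text \<open>Payoff received so far plus expected continuation payoff is a martingale along the play.
  Its constant expectation connects the \<open>n\<close>-stage payoff with the recursion from the
  start.\<close>

lemma expectation_play_step:
  fixes \<mu> :: "'k \<Rightarrow> real"
    and \<sigma> :: "('k, 'a, 'b, 'a) strategy" and \<tau> :: "('l, 'a, 'b, 'b) strategy"
  defines "\<phi> \<equiv> \<lambda>t m (ks, ls, hs). \<mu> (hd ks) + total_payoff G t lam ks ls hs + cont_payoff \<sigma> \<tau> m ks ls hs"
  shows "measure_pmf.expectation (play P Q p q \<sigma> \<tau> (Suc t)) (\<phi> (Suc t) m) =
    measure_pmf.expectation (play P Q p q \<sigma> \<tau> t) (\<phi> t (Suc m))"
proof -
  let ?E = "measure_pmf.expectation"
  have step: "?E (stage P Q \<sigma> \<tau> h) (\<phi> (Suc t) m) = \<phi> t (Suc m) h"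
    if h: "h \<in> set_pmf (play P Q p q \<sigma> \<tau> t)" for h
  proof -
    obtain ks ls hs where h': "h = (ks, ls, hs)" by (cases h)
    have len: "length ks = Suc t" "length ls = Suc t" "length hs = t"
      using length_play h h' by blast+
    then have ne: "ks \<noteq> []" "ls \<noteq> []" by auto
    have last: "last ks = ks ! t" "last ls = ls ! t" using len ne by (simp_all add: last_conv_nth)
    have eq: "\<phi> (Suc t) m (ks @ [k'], ls @ [l'], hs @ [(a, b)]) =
        (\<mu> (hd ks) + total_payoff G t lam ks ls hs) + (lam ^ t * G (last ks) (last ls) a b +
          cont_payoff \<sigma> \<tau> m (ks @ [k']) (ls @ [l']) (hs @ [(a, b)]))" for k' l' a b
      unfolding \<phi>_def total_payoff_def using len ne by (simp add: nth_append last)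
    have dist: "(\<Sum>x\<in>UNIV. pmf p x * (c + f x)) = c + (\<Sum>x\<in>UNIV. pmf p x * f x)"
      for c :: real and p :: "'x::finite pmf" and f
      by (simp add: distrib_left sum.distrib sum_pmf_eq_1 flip: sum_distrib_right)
    show ?thesis
      unfolding h' expectation_stage eq unfolding dist \<phi>_def using len by simp
  qed
  have "?E (play P Q p q \<sigma> \<tau> (Suc t)) (\<phi> (Suc t) m) =
      (\<Sum>h\<in>set_pmf (play P Q p q \<sigma> \<tau> t). pmf (play P Q p q \<sigma> \<tau> t) h * 
        ?E (stage P Q \<sigma> \<tau> h) (\<phi> (Suc t) m))"
    unfolding play.simps
    by (subst pmf_expectation_bind[of "set_pmf (play P Q p q \<sigma> \<tau> t)"])
      (auto simp: finite_set_play finite_set_stage)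
  also have "\<dots> = (\<Sum>h\<in>set_pmf (play P Q p q \<sigma> \<tau> t). \<phi> t (Suc m) h * pmf (play P Q p q \<sigma> \<tau> t) h)"
    by (intro sum.cong) (auto simp: step)
  also have "\<dots> = ?E (play P Q p q \<sigma> \<tau> t) (\<phi> t (Suc m))"
    by (subst integral_measure_pmf_real[of "set_pmf (play P Q p q \<sigma> \<tau> t)"]) (auto simp: finite_set_play)
  finally show ?thesis .
qed

text \<open>Player 1 sees neither the states nor the strategy of player 2, so its payoff is the
  average of \<open>cont_payoff\<close> over the unseen \<open>ls\<close>, weighted by
  \<open>reach\<close>.\<close>

lemma follow_weights:
  assumes "length ks = Suc (length hs)"
  shows "follow \<sigma> (weights r \<tau>) m ks hs =
    (\<Sum>ls | length ls = Suc (length hs). reach r \<tau> ls hs * cont_payoff \<sigma> \<tau> m ks ls hs)"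
  using assms
proof (induction m arbitrary: ks hs)
  case (Suc m)
  let ?A = "{ls :: 'l list. length ls = Suc (length hs)}"
  have "follow \<sigma> (weights r \<tau>) (Suc m) ks hs = (\<Sum>a\<in>UNIV. pmf (\<sigma> ks hs) a *
     (\<Sum>ls\<in>?A. \<Sum>b\<in>UNIV. weights r \<tau> ls hs b * (lam ^ length hs * G (last ks) (last ls) a b +
       (\<Sum>k'\<in>UNIV. pmf (P a b (last ks)) k' * (\<Sum>l'\<in>UNIV. pmf (Q a b (last ls)) l' *
         cont_payoff \<sigma> \<tau> m (ks @ [k']) (ls @ [l']) (hs @ [(a, b)]))))))" (is "_ = (\<Sum>a\<in>UNIV. _ * ?rhs a)")
    unfolding follow.simps
  proof (intro sum.cong refl arg_cong2[where f = "(*)"])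
    fix a
    have "(\<Sum>k'\<in>UNIV. \<Sum>b\<in>UNIV. pmf (P a b (last ks)) k' *
          follow \<sigma> (weights r \<tau>) m (ks @ [k']) (hs @ [(a, b)])) =
        (\<Sum>k'\<in>UNIV. \<Sum>b\<in>UNIV. \<Sum>ls\<in>?A. weights r \<tau> ls hs b * (pmf (P a b (last ks)) k' * 
          (\<Sum>l'\<in>UNIV. pmf (Q a b (last ls)) l' * cont_payoff \<sigma> \<tau> m (ks @ [k']) (ls @ [l']) (hs @ [(a, b)]))))"
      using Suc by (simp add: sum_lists_snoc reach_snoc sum_distrib_left mult_ac)
    \<comment> \<open>By \<open>reach_snoc\<close> the probabilities of \<open>b\<close> and of the
      next state of player 2 have left \<open>reach\<close>; after the exchange of sums they stand
      where \<open>cont_payoff\<close> expects them.\<close>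
    also have "\<dots> = (\<Sum>ls\<in>?A. \<Sum>b\<in>UNIV. \<Sum>k'\<in>UNIV. weights r \<tau> ls hs b * (pmf (P a b (last ks)) k' * 
          (\<Sum>l'\<in>UNIV. pmf (Q a b (last ls)) l' * cont_payoff \<sigma> \<tau> m (ks @ [k']) (ls @ [l']) (hs @ [(a, b)]))))"
      by (rule sum_swap3)
    finally show "stage_cost (weights r \<tau>) ks hs a +
        (\<Sum>k'\<in>UNIV. \<Sum>b\<in>UNIV. pmf (P a b (last ks)) k' *
          follow \<sigma> (weights r \<tau>) m (ks @ [k']) (hs @ [(a, b)])) = ?rhs a"
      by (simp add: stage_cost_def sum.distrib distrib_left sum_distrib_left mult.assoc)
  qed
  also have "\<dots> = (\<Sum>ls\<in>?A. reach r \<tau> ls hs * cont_payoff \<sigma> \<tau> (Suc m) ks ls hs)"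
    unfolding cont_payoff.simps weights_def sum_distrib_left
    by (subst sum.swap) (simp add: mult_ac)
  finally show ?case .
qed simp

lemma payoff1_eq:
  "payoff1 G P Q n lam \<mu> p q \<sigma> \<tau> =
    (\<Sum>k\<in>UNIV. pmf p k * (\<mu> k + follow \<sigma> (weights (pmf q) \<tau>) n [k] []))"
proof -
  let ?E = "measure_pmf.expectation"
  define \<phi> where "\<phi> = (\<lambda>t m (ks, ls, hs).
     \<mu> (hd ks) + total_payoff G t lam ks ls hs + cont_payoff \<sigma> \<tau> m ks ls hs)"
  \<comment> \<open>Moves all \<open>t\<close> stages from the play into the continuation payoff,
    one martingale step at a time.\<close>
  have *: "?E (play P Q p q \<sigma> \<tau> t) (\<phi> t m) = ?E (play P Q p q \<sigma> \<tau> 0) (\<phi> 0 (t + m))" for t m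
    by (induction t arbitrary: m) (simp_all only: \<phi>_def expectation_play_step add_Suc_right add_Suc add_0)
  have "payoff1 G P Q n lam \<mu> p q \<sigma> \<tau> = ?E (play P Q p q \<sigma> \<tau> n) (\<phi> n 0)"
    unfolding payoff1_def \<phi>_def by (intro Bochner_Integration.integral_cong) auto
  also have "\<dots> = ?E (play P Q p q \<sigma> \<tau> 0) (\<phi> 0 n)"
    using * by simp
  also have "\<dots> = (\<Sum>k\<in>UNIV. pmf p k * (\<Sum>l\<in>UNIV. pmf q l * (\<mu> k + cont_payoff \<sigma> \<tau> n [k] [l] [])))"
    by (simp add: expectation_bind_finite set_bind_pmf \<phi>_def total_payoff_def)
  also have "\<dots> = (\<Sum>k\<in>UNIV. pmf p k * (\<mu> k + follow \<sigma> (weights (pmf q) \<tau>) n [k] []))"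
    by (simp add: follow_weights sum_lists_one distrib_left sum.distrib sum_pmf_eq_1 flip: sum_distrib_right)
  finally show ?thesis .
qed


subsection \<open>Best replies of player 1\<close>

lemma follow_le_best: "follow \<sigma> S m ks hs \<le> best S m ks hs"
proof (induction m arbitrary: ks hs)
  case (Suc m)
  have "stage_cost S ks hs a + (\<Sum>k'\<in>UNIV. \<Sum>b\<in>UNIV. pmf (P a b (last ks)) k' *
       follow \<sigma> S m (ks @ [k']) (hs @ [(a, b)])) \<le> best S (Suc m) ks hs" for a
    unfolding best.simps
    by (rule order_trans[OF _ Max_ge[OF _ rangeI[of _ a]]])
      (auto intro!: sum_mono mult_left_mono Suc)
  then show ?case unfolding follow.simps by (rule pmf_weighted_le)
qed simp

lemma best_ge:
  "stage_cost S ks hs a + (\<Sum>k'\<in>UNIV. \<Sum>b\<in>UNIV. pmf (P a b (last ks)) k' *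
     best S m (ks @ [k']) (hs @ [(a, b)])) \<le> best S (Suc m) ks hs"
  by simp

lemma best_le:
  assumes "\<And>a. stage_cost S ks hs a + (\<Sum>k'\<in>UNIV. \<Sum>b\<in>UNIV. pmf (P a b (last ks)) k' *
     best S m (ks @ [k']) (hs @ [(a, b)])) \<le> c"
  shows "best S (Suc m) ks hs \<le> c"
  using assms by simp

lemma stage_cost_cong:
  assumes "\<And>ls b. length ls = Suc (length hs) \<Longrightarrow> S ls hs b = S' ls hs b"
  shows "stage_cost S ks hs a = stage_cost S' ks hs a"
  unfolding stage_cost_def using assms by simp

text \<open>With \<open>m\<close> stages left after \<open>hs\<close>, the last stage cost is taken
  at an action history of length \<open>length hs + m - 1\<close>, hence at lists \<open>ls\<close>
  of length \<open>length hs + m\<close>. This is the range in which \<open>plan_realized\<close>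
  must agree with \<open>S\<close>.\<close>

lemma follow_cong:
  assumes "\<And>ls hs' b. length ls = Suc (length hs') \<Longrightarrow> length ls \<le> length hs + m \<Longrightarrow> S ls hs' b = S' ls hs' b"
  shows "follow \<sigma> S m ks hs = follow \<sigma> S' m ks hs"
  using assms
proof (induction m arbitrary: ks hs)
  case (Suc m)
  have "stage_cost S ks hs a = stage_cost S' ks hs a" for a
    by (rule stage_cost_cong) (simp add: Suc.prems)
  moreover have "follow \<sigma> S m (ks @ [k']) (hs @ [(a, b)]) = follow \<sigma> S' m (ks @ [k']) (hs @ [(a, b)])"
    for k' a b by (rule Suc.IH) (simp add: Suc.prems)
  ultimately show ?case by simp
qed simp

lemma best_cong:
  assumes "\<And>ls hs' b. length ls = Suc (length hs') \<Longrightarrow> length ls \<le> length hs + m \<Longrightarrow> S ls hs' b = S' ls hs' b"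
  shows "best S m ks hs = best S' m ks hs"
  using assms
proof (induction m arbitrary: ks hs)
  case (Suc m)
  have "stage_cost S ks hs a = stage_cost S' ks hs a" for a
    by (rule stage_cost_cong) (simp add: Suc.prems)
  moreover have "best S m (ks @ [k']) (hs @ [(a, b)]) = best S' m (ks @ [k']) (hs @ [(a, b)])"
    for k' a b by (rule Suc.IH) (simp add: Suc.prems)
  ultimately show ?case by simp
qed simp

lemma follow_linear:
  "follow \<sigma> (\<lambda>ls hs b. t * S ls hs b + u * S' ls hs b) m ks hs =
    t * follow \<sigma> S m ks hs + u * follow \<sigma> S' m ks hs"
proof (induction m arbitrary: ks hs)
  case (Suc m)
  have "stage_cost (\<lambda>ls hs b. t * S ls hs b + u * S' ls hs b) ks hs a =
      t * stage_cost S ks hs a + u * stage_cost S' ks hs a" for a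
    by (simp add: stage_cost_def sum_distrib_left sum.distrib distrib_right mult.assoc)
  then show ?case
    by (simp add: Suc.IH sum_distrib_left sum.distrib distrib_left mult_ac)
qed simp

lemma follow_local:
  assumes "\<And>ks' hs'. \<sigma> (ks @ ks') (hs @ hs') = \<sigma>' (ks @ ks') (hs @ hs')"
  shows "follow \<sigma> S m ks hs = follow \<sigma>' S m ks hs"
  using assms
proof (induction m arbitrary: ks hs)
  case (Suc m)
  have "follow \<sigma> S m (ks @ [k']) (hs @ [(a, b)]) = follow \<sigma>' S m (ks @ [k']) (hs @ [(a, b)])"
    for k' a b by (rule Suc.IH) (simp add: Suc.prems)
  moreover have "\<sigma> ks hs = \<sigma>' ks hs" using Suc.prems[of "[]" "[]"] by simp
  ultimately show ?case by simp
qed simp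

text \<open>Plays \<open>x\<close> at \<open>hs\<close> and then the continuation strategy selected
  by the action pair and state that directly follow. At histories that do not extend
  \<open>hs\<close> its values are arbitrary, because \<open>follow\<close> never consults
  them.\<close>

definition glue ::
  "'k list \<Rightarrow> ('a \<times> 'b) list \<Rightarrow> 'a pmf \<Rightarrow> ('a \<times> 'b \<times> 'k \<Rightarrow> ('k, 'a, 'b, 'a) strategy) \<Rightarrow>
   ('k, 'a, 'b, 'a) strategy" where
  "glue ks hs x c ks' hs' = (if length hs' \<le> length hs then x
     else c (fst (hs' ! length hs), snd (hs' ! length hs), ks' ! length ks) ks' hs')"

lemma follow_glue:
  "follow (glue ks hs x c) S (Suc m) ks hs = (\<Sum>a\<in>UNIV. pmf x a * (stage_cost S ks hs a +
     (\<Sum>k'\<in>UNIV. \<Sum>b\<in>UNIV. pmf (P a b (last ks)) k' *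
        follow (c (a, b, k')) S m (ks @ [k']) (hs @ [(a, b)]))))"
proof -
  have "follow (glue ks hs x c) S m (ks @ [k']) (hs @ [(a, b)]) =
      follow (c (a, b, k')) S m (ks @ [k']) (hs @ [(a, b)])" for a b k'
    by (rule follow_local) (simp add: glue_def nth_append)
  then show ?thesis by (simp add: glue_def)
qed

text \<open>Pure strategies contain a best reply, and \<open>m\<close> stages admit only finitely
  many pure choices. The point is that \<open>F\<close> does not depend on \<open>S\<close>;
  \<open>minimax\<close> needs such a finite family.\<close>

lemma finite_best_replies:
  "\<exists>F. finite F \<and> (\<forall>S. \<exists>\<sigma>\<in>F. follow \<sigma> S m ks hs = best S m ks hs)"
proof (induction m arbitrary: ks hs)
  case 0
  show ?case by (rule exI[of _ "{undefined}"]) simp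
next
  case (Suc m)
  have "\<exists>F. \<forall>a b k'. finite (F (a, b, k')) \<and> (\<forall>S. \<exists>\<sigma>\<in>F (a, b, k').
      follow \<sigma> S m (ks @ [k']) (hs @ [(a, b)]) = best S m (ks @ [k']) (hs @ [(a, b)]))"
    using choice[of "\<lambda>(a, b, k') F. finite F \<and> (\<forall>S. \<exists>\<sigma>\<in>F.
      follow \<sigma> S m (ks @ [k']) (hs @ [(a, b)]) = best S m (ks @ [k']) (hs @ [(a, b)]))"] Suc
    by auto
  then obtain F where fin: "\<And>i. finite (F i)"
    and F: "\<And>a b k' S. \<exists>\<sigma>\<in>F (a, b, k').
      follow \<sigma> S m (ks @ [k']) (hs @ [(a, b)]) = best S m (ks @ [k']) (hs @ [(a, b)])"
    by (metis prod_cases3)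
  \<comment> \<open>All combinations of a pure first action with continuations from the finite sets.
    The functions are extensional on \<open>UNIV\<close>, which makes their number finite.\<close>
  define E where "E = (\<lambda>(a, c). glue ks hs (return_pmf a) c) ` (UNIV \<times> PiE UNIV F)"
  have "finite E" unfolding E_def by (intro finite_imageI finite_cartesian_product finite_PiE) (auto simp: fin)
  moreover have "\<exists>\<sigma>\<in>E. follow \<sigma> S (Suc m) ks hs = best S (Suc m) ks hs" for S
  proof -
    have "\<exists>c. \<forall>a b k'. c (a, b, k') \<in> F (a, b, k') \<and>
        follow (c (a, b, k')) S m (ks @ [k']) (hs @ [(a, b)]) = best S m (ks @ [k']) (hs @ [(a, b)])"
      using choice[of "\<lambda>(a, b, k') \<sigma>. \<sigma> \<in> F (a, b, k') \<and>
        follow \<sigma> S m (ks @ [k']) (hs @ [(a, b)]) = best S m (ks @ [k']) (hs @ [(a, b)])"] F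
      by fastforce
    then obtain c where c: "\<And>a b k'. c (a, b, k') \<in> F (a, b, k')"
        "\<And>a b k'. follow (c (a, b, k')) S m (ks @ [k']) (hs @ [(a, b)]) = best S m (ks @ [k']) (hs @ [(a, b)])"
      by blast
    define v where "v a = stage_cost S ks hs a + (\<Sum>k'\<in>UNIV. \<Sum>b\<in>UNIV. pmf (P a b (last ks)) k' *
        best S m (ks @ [k']) (hs @ [(a, b)]))" for a
    have "Max (range v) \<in> range v" by (intro Max_in) auto
    then obtain a where a: "Max (range v) = v a" by (rule rangeE)
    have "follow (glue ks hs (return_pmf a) c) S (Suc m) ks hs = v a"
      unfolding follow_glue c(2) v_def[symmetric] by (rule pmf_weighted_return)
    also have "\<dots> = best S (Suc m) ks hs" using a by (simp add: v_def[abs_def])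
    finally show ?thesis
      by (intro bexI[of _ "glue ks hs (return_pmf a) c"]) (use c(1) in \<open>auto simp: E_def PiE_def Pi_def\<close>)
  qed
  ultimately show ?case by blast
qed

text \<open>Perfect recall: a mixture of two behaviour strategies is realized by the behaviour strategy
  that updates the mixing weight with its own past actions (Kuhn's theorem).\<close>

lemma follow_mixture:
  assumes "0 \<le> t" "t \<le> 1"
  shows "\<exists>\<sigma>. \<forall>S. follow \<sigma> S m ks hs = t * follow \<sigma>1 S m ks hs + (1 - t) * follow \<sigma>2 S m ks hs"
  using assms
proof (induction m arbitrary: t ks hs)
  case (Suc m)
  let ?x1 = "\<sigma>1 ks hs" and ?x2 = "\<sigma>2 ks hs"
  obtain x where x: "\<And>a. pmf x a = t * pmf ?x1 a + (1 - t) * pmf ?x2 a"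
    using ex_mix_pmf[OF Suc.prems, of ?x1 ?x2] by blast
  have "\<exists>u. 0 \<le> u \<and> u \<le> 1 \<and> (\<forall>f g. t * (pmf ?x1 a * f) + (1 - t) * (pmf ?x2 a * g) =
      pmf x a * (u * f + (1 - u) * g))" for a
    using mixture_weights[OF Suc.prems pmf_nonneg pmf_nonneg, of ?x1 a ?x2 a] unfolding x by metis
  then obtain u where u: "\<And>a. 0 \<le> u a" "\<And>a. u a \<le> 1"
    "\<And>a f g. t * (pmf ?x1 a * f) + (1 - t) * (pmf ?x2 a * g) =
      pmf x a * (u a * f + (1 - u a) * g)"
    by metis
  have "\<exists>\<sigma>. \<forall>S. follow \<sigma> S m (ks @ [k']) (hs @ [(a, b)]) =
      u a * follow \<sigma>1 S m (ks @ [k']) (hs @ [(a, b)]) +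
      (1 - u a) * follow \<sigma>2 S m (ks @ [k']) (hs @ [(a, b)])" for a b k'
    using Suc.IH u by blast
  then have "\<exists>c. \<forall>a b k'. \<forall>S. follow (c (a, b, k')) S m (ks @ [k']) (hs @ [(a, b)]) =
      u a * follow \<sigma>1 S m (ks @ [k']) (hs @ [(a, b)]) +
      (1 - u a) * follow \<sigma>2 S m (ks @ [k']) (hs @ [(a, b)])"
    using choice[of "\<lambda>(a, b, k') \<sigma>. \<forall>S. follow \<sigma> S m (ks @ [k']) (hs @ [(a, b)]) =
      u a * follow \<sigma>1 S m (ks @ [k']) (hs @ [(a, b)]) +
      (1 - u a) * follow \<sigma>2 S m (ks @ [k']) (hs @ [(a, b)])"]
    by fastforce
  then obtain c where c: "\<And>a b k' S. follow (c (a, b, k')) S m (ks @ [k']) (hs @ [(a, b)]) =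
      u a * follow \<sigma>1 S m (ks @ [k']) (hs @ [(a, b)]) +
      (1 - u a) * follow \<sigma>2 S m (ks @ [k']) (hs @ [(a, b)])"
    by blast
  have "follow (glue ks hs x c) S (Suc m) ks hs =
      t * follow \<sigma>1 S (Suc m) ks hs + (1 - t) * follow \<sigma>2 S (Suc m) ks hs" for S
  proof -
    define f where "f \<sigma> a = stage_cost S ks hs a + (\<Sum>k'\<in>UNIV. \<Sum>b\<in>UNIV. pmf (P a b (last ks)) k' *
        follow \<sigma> S m (ks @ [k']) (hs @ [(a, b)]))" for \<sigma> a
    have "stage_cost S ks hs a + (\<Sum>k'\<in>UNIV. \<Sum>b\<in>UNIV. pmf (P a b (last ks)) k' *
        follow (c (a, b, k')) S m (ks @ [k']) (hs @ [(a, b)])) = u a * f \<sigma>1 a + (1 - u a) * f \<sigma>2 a" for a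
    proof -
      have "u a * f \<sigma>1 a + (1 - u a) * f \<sigma>2 a = (u a * stage_cost S ks hs a + (1 - u a) * stage_cost S ks hs a)
         + (\<Sum>k'\<in>UNIV. \<Sum>b\<in>UNIV. pmf (P a b (last ks)) k' *
           (u a * follow \<sigma>1 S m (ks @ [k']) (hs @ [(a, b)]) +
            (1 - u a) * follow \<sigma>2 S m (ks @ [k']) (hs @ [(a, b)])))"
        by (simp only: f_def distrib_left sum_distrib_left sum.distrib mult.left_commute add_ac)
      also have "u a * stage_cost S ks hs a + (1 - u a) * stage_cost S ks hs a = stage_cost S ks hs a"
        by (simp add: algebra_simps)
      finally show ?thesis by (simp add: c)
    qed
    then have "follow (glue ks hs x c) S (Suc m) ks hs =
        (\<Sum>a\<in>UNIV. pmf x a * (u a * f \<sigma>1 a + (1 - u a) * f \<sigma>2 a))"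
      unfolding follow_glue by simp
    also have "\<dots> = (\<Sum>a\<in>UNIV. t * (pmf ?x1 a * f \<sigma>1 a) + (1 - t) * (pmf ?x2 a * f \<sigma>2 a))"
      by (simp only: u(3))
    also have "\<dots> = t * follow \<sigma>1 S (Suc m) ks hs + (1 - t) * follow \<sigma>2 S (Suc m) ks hs"
      by (simp add: f_def sum.distrib sum_distrib_left)
    finally show ?thesis .
  qed
  then show ?case by blast
qed simp


subsection \<open>The value of the dual game\<close>

text \<open>\<open>payoff1\<close> extended from the weights of a strategy to arbitrary
  \<open>S\<close>.\<close>

definition dual_payoff ::
  "nat \<Rightarrow> ('k \<Rightarrow> real) \<Rightarrow> 'k pmf \<Rightarrow> ('k, 'a, 'b, 'a) strategy \<Rightarrow>
   ('l list \<Rightarrow> ('a \<times> 'b) list \<Rightarrow> 'b \<Rightarrow> real) \<Rightarrow> real" where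
  "dual_payoff n \<mu> p \<sigma> S = (\<Sum>k\<in>UNIV. pmf p k * (\<mu> k + follow \<sigma> S n [k] []))"

text \<open>Since \<open>p\<close> belongs to player 1's strategy, the drawn state already tells
  which of the two strategies is being followed. The mixing weight is therefore updated to
  \<open>u k\<close> before the first action, and a separate mixture is used for each initial
  state.\<close>

lemma dual_payoff_mixture:
  assumes "0 \<le> t" "t \<le> 1"
  shows "\<exists>p \<sigma>. \<forall>S. dual_payoff n \<mu> p \<sigma> S = t * dual_payoff n \<mu> p1 \<sigma>1 S + (1 - t) * dual_payoff n \<mu> p2 \<sigma>2 S"
proof -
  obtain p where p: "\<And>k. pmf p k = t * pmf p1 k + (1 - t) * pmf p2 k"
    using ex_mix_pmf[OF assms, of p1 p2] by blast
  have "\<exists>u. 0 \<le> u \<and> u \<le> 1 \<and> (\<forall>f g. t * (pmf p1 k * f) + (1 - t) * (pmf p2 k * g) =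
      pmf p k * (u * f + (1 - u) * g))" for k
    using mixture_weights[OF assms pmf_nonneg pmf_nonneg, of p1 k p2 k] unfolding p by metis
  then obtain u where u: "\<And>k. 0 \<le> u k" "\<And>k. u k \<le> 1"
    "\<And>k f g. t * (pmf p1 k * f) + (1 - t) * (pmf p2 k * g) = pmf p k * (u k * f + (1 - u k) * g)"
    by metis
  have "\<exists>c. \<forall>k S. follow (c k) S n [k] [] =
      u k * follow \<sigma>1 S n [k] [] + (1 - u k) * follow \<sigma>2 S n [k] []"
    by (rule choice) (use follow_mixture u in blast)
  then obtain c where c: "\<And>k S. follow (c k) S n [k] [] =
      u k * follow \<sigma>1 S n [k] [] + (1 - u k) * follow \<sigma>2 S n [k] []"
    by blast
  define \<sigma> :: "('k, 'a, 'b, 'a) strategy" where "\<sigma> = (\<lambda>ks. c (hd ks) ks)"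
  have "follow \<sigma> S n [k] [] = follow (c k) S n [k] []" for k S
    by (rule follow_local) (simp add: \<sigma>_def)
  then have "\<mu> k + follow \<sigma> S n [k] [] =
      u k * (\<mu> k + follow \<sigma>1 S n [k] []) + (1 - u k) * (\<mu> k + follow \<sigma>2 S n [k] [])" for k S
    by (simp add: c) (simp add: algebra_simps)
  then have "dual_payoff n \<mu> p \<sigma> S = (\<Sum>k\<in>UNIV. pmf p k *
      (u k * (\<mu> k + follow \<sigma>1 S n [k] []) + (1 - u k) * (\<mu> k + follow \<sigma>2 S n [k] [])))" for S
    unfolding dual_payoff_def by simp
  then show ?thesis
    unfolding u(3)[symmetric]
    by (intro exI[of _ p] exI[of _ \<sigma>]) (simp add: dual_payoff_def sum.distrib sum_distrib_left)
qed

lemma plan_convex: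
  assumes "plan r N S" "plan r N S'" "0 \<le> t" "0 \<le> u" "t + u = 1"
  shows "plan r N (\<lambda>ls hs b. t * S ls hs b + u * S' ls hs b)"
proof -
  have "t * c + u * c = c" for c using assms(5) by (simp flip: distrib_right)
  then show ?thesis
    using assms(1-4) unfolding plan_def
    by (auto simp: sum.distrib distrib_left mult.left_commute simp flip: sum_distrib_left)
qed

text \<open>A convex combination of two weight systems satisfies the same linear constraints, so it
  is again realized by a behaviour strategy, one that serves all replies of player 1
  simultaneously.\<close>

lemma dual_payoff_convex:
  assumes "0 \<le> t" "t \<le> 1"
  shows "\<exists>\<tau>. \<forall>p \<sigma>. dual_payoff n \<mu> p \<sigma> (weights (pmf q) \<tau>) =
    t * dual_payoff n \<mu> p \<sigma> (weights (pmf q) \<tau>1) + (1 - t) * dual_payoff n \<mu> p \<sigma> (weights (pmf q) \<tau>2)"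
proof -
  let ?S = "\<lambda>ls hs b. t * weights (pmf q) \<tau>1 ls hs b + (1 - t) * weights (pmf q) \<tau>2 ls hs b"
  have "plan (pmf q) n (weights (pmf q) \<tau>1)" "plan (pmf q) n (weights (pmf q) \<tau>2)"
    by (auto intro: plan_weights)
  then have "plan (pmf q) n ?S"
    by (rule plan_convex) (use assms in auto)
  then obtain \<tau> where \<tau>: "\<And>s ls hs b. is_info s ls hs \<Longrightarrow> s \<le> n \<Longrightarrow> ?S ls hs b = weights (pmf q) \<tau> ls hs b"
    by (rule plan_realized) blast
  have "follow \<sigma> (weights (pmf q) \<tau>) n [k] [] = follow \<sigma> ?S n [k] []" for \<sigma> k
    by (rule follow_cong) (simp add: \<tau>[symmetric] is_info_def)
  then have *: "follow \<sigma> (weights (pmf q) \<tau>) n [k] [] =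
      t * follow \<sigma> (weights (pmf q) \<tau>1) n [k] [] + (1 - t) * follow \<sigma> (weights (pmf q) \<tau>2) n [k] []" for \<sigma> k
    by (simp only: follow_linear)
  have "\<mu> k + follow \<sigma> (weights (pmf q) \<tau>) n [k] [] =
      t * (\<mu> k + follow \<sigma> (weights (pmf q) \<tau>1) n [k] []) +
      (1 - t) * (\<mu> k + follow \<sigma> (weights (pmf q) \<tau>2) n [k] [])" for \<sigma> k
    unfolding * by (simp add: algebra_simps)
  then show ?thesis
    unfolding dual_payoff_def
    by (intro exI[of _ \<tau>] allI) (simp add: sum_distrib_left distrib_left sum.distrib mult.left_commute)
qed

lemma dual_payoff_le:
  assumes "\<And>k. \<mu> k + best S n [k] [] \<le> c"
  shows "dual_payoff n \<mu> p \<sigma> S \<le> c"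
  unfolding dual_payoff_def
  by (intro pmf_weighted_le order_trans[OF add_left_mono[OF follow_le_best]] assms)

lemma ex_finite_dual_best_replies:
  "\<exists>F. finite F \<and> F \<noteq> {} \<and> (\<forall>S k. \<exists>(p, \<sigma>)\<in>F. dual_payoff n \<mu> p \<sigma> S = \<mu> k + best S n [k] [])"
proof -
  have "\<exists>F. \<forall>k. finite (F k) \<and> (\<forall>S. \<exists>\<sigma>\<in>F k. follow \<sigma> S n [k] [] = best S n [k] [])"
    by (rule choice) (use finite_best_replies in blast)
  then obtain F where F: "\<And>k. finite (F k)" "\<And>k S. \<exists>\<sigma>\<in>F k. follow \<sigma> S n [k] [] = best S n [k] []"
    by blast
  define E where "E = (\<Union>k. (\<lambda>\<sigma>. (return_pmf k, \<sigma>)) ` F k)"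
  have E: "\<exists>(p, \<sigma>)\<in>E. dual_payoff n \<mu> p \<sigma> S = \<mu> k + best S n [k] []" for S k
  proof -
    obtain \<sigma> where "\<sigma> \<in> F k" "follow \<sigma> S n [k] [] = best S n [k] []" using F(2) by blast
    moreover from this have "dual_payoff n \<mu> (return_pmf k) \<sigma> S = \<mu> k + best S n [k] []"
      unfolding dual_payoff_def pmf_weighted_return by simp
    ultimately show ?thesis by (auto simp: E_def)
  qed
  moreover from this have "E \<noteq> {}" by blast
  moreover have "finite E" using F(1) by (simp add: E_def)
  ultimately show ?thesis by blast
qed

lemma dual_payoff_best_reply: "\<exists>p \<sigma>. dual_payoff n \<mu> p \<sigma> S = \<mu> k + best S n [k] []"
  using ex_finite_dual_best_replies[of n \<mu>] by blast

text \<open>The minimax principle for the functions payoff minus \<open>v\<close> of player 2's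
  strategy: they form a convex set by perfect recall, they are affine along mixtures of player 2,
  and the finitely many best replies reach \<open>v\<close> against each single strategy.\<close>

lemma ex_guarantee:
  assumes "\<And>\<tau>. \<exists>k. v \<le> \<mu> k + best (weights (pmf q) \<tau>) n [k] []"
  shows "\<exists>p \<sigma>. \<forall>\<tau>. v \<le> dual_payoff n \<mu> p \<sigma> (weights (pmf q) \<tau>)"
proof -
  let ?f = "\<lambda>p \<sigma> \<tau>. dual_payoff n \<mu> p \<sigma> (weights (pmf q) \<tau>) - v"
  define D where "D = {f. \<exists>p \<sigma>. f = ?f p \<sigma>}"
  obtain F where F: "finite F" "F \<noteq> {}"
    "\<And>S k. \<exists>(p, \<sigma>)\<in>F. dual_payoff n \<mu> p \<sigma> S = \<mu> k + best S n [k] []"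
    using ex_finite_dual_best_replies[of n \<mu>] by (elim exE conjE) blast
  have "\<exists>f\<in>D. \<forall>\<tau>\<in>UNIV. 0 \<le> f \<tau>"
  proof (rule minimax)
    show "finite ((\<lambda>(p, \<sigma>). ?f p \<sigma>) ` F)" "(\<lambda>(p, \<sigma>). ?f p \<sigma>) ` F \<noteq> {}" using F by auto
    show "(\<lambda>(p, \<sigma>). ?f p \<sigma>) ` F \<subseteq> D" by (auto simp: D_def)
    show "\<exists>f\<in>(\<lambda>(p, \<sigma>). ?f p \<sigma>) ` F. 0 \<le> f \<tau>" for \<tau>
    proof -
      obtain k where k: "v \<le> \<mu> k + best (weights (pmf q) \<tau>) n [k] []" using assms by blast
      obtain p \<sigma> where "(p, \<sigma>) \<in> F" "dual_payoff n \<mu> p \<sigma> (weights (pmf q) \<tau>) = \<mu> k + best (weights (pmf q) \<tau>) n [k] []"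
        using F(3)[of "weights (pmf q) \<tau>" k] by blast
      then show ?thesis using k by (intro bexI[of _ "?f p \<sigma>"]) force+
    qed
  next
    fix f g and t :: real
    assume *: "f \<in> D" "g \<in> D" "0 \<le> t" "t \<le> 1"
    then obtain p1 \<sigma>1 p2 \<sigma>2 where "f = ?f p1 \<sigma>1" "g = ?f p2 \<sigma>2" by (auto simp: D_def)
    moreover obtain p \<sigma> where "\<And>S. dual_payoff n \<mu> p \<sigma> S = t * dual_payoff n \<mu> p1 \<sigma>1 S + (1 - t) * dual_payoff n \<mu> p2 \<sigma>2 S"
      using dual_payoff_mixture[OF *(3,4), of n \<mu> p1 \<sigma>1 p2 \<sigma>2] by blast
    ultimately have "(\<lambda>\<tau>. t * f \<tau> + (1 - t) * g \<tau>) = ?f p \<sigma>"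
      by (intro ext) (simp, simp add: algebra_simps)
    then show "(\<lambda>\<tau>. t * f \<tau> + (1 - t) * g \<tau>) \<in> D" by (auto simp: D_def)
  next
    fix \<tau>1 \<tau>2 and t :: real
    assume *: "0 \<le> t" "t \<le> 1"
    obtain \<tau> where "\<And>p \<sigma>. dual_payoff n \<mu> p \<sigma> (weights (pmf q) \<tau>) =
        t * dual_payoff n \<mu> p \<sigma> (weights (pmf q) \<tau>1) + (1 - t) * dual_payoff n \<mu> p \<sigma> (weights (pmf q) \<tau>2)"
      using dual_payoff_convex[OF *, of n \<mu> q \<tau>1 \<tau>2] by blast
    then have "\<forall>f\<in>D. f \<tau> = t * f \<tau>1 + (1 - t) * f \<tau>2"
      unfolding D_def by clarsimp (simp add: algebra_simps)
    then show "\<exists>\<tau>\<in>UNIV. \<forall>f\<in>D. f \<tau> = t * f \<tau>1 + (1 - t) * f \<tau>2" by blast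
  qed
  then obtain f where f: "f \<in> D" "\<And>\<tau>. 0 \<le> f \<tau>" by blast
  then obtain p \<sigma> where "f = ?f p \<sigma>" unfolding D_def by blast
  then show ?thesis using f(2) by (intro exI[of _ p] exI[of _ \<sigma>]) simp
qed

abbreviation best_reply :: "nat \<Rightarrow> 'l pmf \<Rightarrow> ('l, 'a, 'b, 'b) strategy \<Rightarrow> 'k \<Rightarrow> real" where
  "best_reply n q \<tau> k \<equiv> best (weights (pmf q) \<tau>) n [k] []"

lemma payoff1_eq_dual_payoff:
  "payoff1 G P Q n lam \<mu> p q \<sigma> \<tau> = dual_payoff n \<mu> p \<sigma> (weights (pmf q) \<tau>)"
  by (simp add: payoff1_eq dual_payoff_def)

lemma payoff1_bounded: "\<exists>B. \<forall>p \<sigma> \<tau>. \<bar>payoff1 G P Q n lam \<mu> p q \<sigma> \<tau>\<bar> \<le> B"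
proof -
  define M where "M = (\<Sum>k\<in>UNIV. \<Sum>l\<in>UNIV. \<Sum>a\<in>UNIV. \<Sum>b\<in>UNIV. \<bar>G k l a b\<bar>)"
  define B where "B = (\<Sum>k\<in>UNIV. \<bar>\<mu> k\<bar>) + (\<Sum>t<n. lam ^ t * M)"
  have G: "\<bar>G k l a b\<bar> \<le> M" for k l a b
    unfolding M_def
    by (rule order_trans[OF _ member_le_sum[of k]], rule order_trans[OF _ member_le_sum[of l]],
        rule order_trans[OF _ member_le_sum[of a]], rule member_le_sum[of b])
      (auto intro!: sum_nonneg)
  have "\<bar>\<mu> (hd ks) + total_payoff G n lam ks ls hs\<bar> \<le> B" for ks ls hs
  proof -
    have "\<bar>\<mu> (hd ks)\<bar> \<le> (\<Sum>k\<in>UNIV. \<bar>\<mu> k\<bar>)" by (rule member_le_sum) auto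
    moreover have "\<bar>total_payoff G n lam ks ls hs\<bar> \<le> (\<Sum>t<n. lam ^ t * M)"
      unfolding total_payoff_def
      by (rule order_trans[OF sum_abs], rule sum_mono)
        (auto simp: abs_mult lam_nonneg intro!: mult_left_mono G)
    ultimately show ?thesis unfolding B_def by linarith
  qed
  then have "\<bar>case h of (ks, ls, hs) \<Rightarrow> \<mu> (hd ks) + total_payoff G n lam ks ls hs\<bar> \<le> B" for h
    by (cases h) simp
  then have b: "- B \<le> (case h of (ks, ls, hs) \<Rightarrow> \<mu> (hd ks) + total_payoff G n lam ks ls hs)"
    "(case h of (ks, ls, hs) \<Rightarrow> \<mu> (hd ks) + total_payoff G n lam ks ls hs) \<le> B" for h
    using abs_le_iff minus_le_iff by blast+
  have int: "integrable (measure_pmf (play P Q p q \<sigma> \<tau> n)) f" for p \<sigma> \<tau> and f :: "_ \<Rightarrow> real"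
    by (rule integrable_measure_pmf_finite) (rule finite_set_play)
  have "- B \<le> payoff1 G P Q n lam \<mu> p q \<sigma> \<tau> \<and> payoff1 G P Q n lam \<mu> p q \<sigma> \<tau> \<le> B" for p \<sigma> \<tau>
    unfolding payoff1_def
    by (intro conjI measure_pmf.integral_ge_const measure_pmf.integral_le_const int AE_pmfI b)
  then show ?thesis using abs_le_iff minus_le_iff by blast
qed

text \<open>Player 1's free choice of \<open>p\<close> turns a bound against all its strategies into
  one inequality per initial state. This is the origin of the constraints indexed by
  \<open>k\<close>.\<close>

lemma guarantee_iff:
  "(\<forall>p \<sigma>. payoff1 G P Q n lam \<mu> p q \<sigma> \<tau> \<le> c) \<longleftrightarrow> (\<forall>k. \<mu> k + best_reply n q \<tau> k \<le> c)"
  unfolding payoff1_eq_dual_payoff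
  by (metis dual_payoff_le dual_payoff_best_reply)

lemma w1_has_value:
  "has_value (\<lambda>(p, \<sigma>) \<tau>. payoff1 G P Q n lam \<mu> p q \<sigma> \<tau>) (w1 G P Q n lam \<mu> q)"
  and w1_eq: "w1 G P Q n lam \<mu> q = (INF \<tau>. SUP (p, \<sigma>). payoff1 G P Q n lam \<mu> p q \<sigma> \<tau>)"
proof -
  let ?f = "\<lambda>(p, \<sigma>) \<tau>. payoff1 G P Q n lam \<mu> p q \<sigma> \<tau>"
  obtain B where B: "\<And>p \<sigma> \<tau>. \<bar>payoff1 G P Q n lam \<mu> p q \<sigma> \<tau>\<bar> \<le> B" using payoff1_bounded by blast
  have "has_value ?f (INF \<tau>. SUP s. ?f s \<tau>)"
  proof (rule has_valueI)
    show "\<bar>?f s \<tau>\<bar> \<le> B" for s \<tau> using B by (cases s) simp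
    fix v
    assume v: "\<And>\<tau>. v \<le> (SUP s. ?f s \<tau>)"
    have "\<exists>k. v \<le> \<mu> k + best_reply n q \<tau> k" for \<tau>
    proof (rule ccontr)
      assume neg: "\<nexists>k. v \<le> \<mu> k + best_reply n q \<tau> k"
      \<comment> \<open>With finitely many states the bounds below \<open>v\<close> have a maximum
        still below \<open>v\<close>; this gap also separates the supremum over player 1's
        strategies from \<open>v\<close>.\<close>
      define c where "c = (MAX k. \<mu> k + best_reply n q \<tau> k)"
      have "c \<in> range (\<lambda>k. \<mu> k + best_reply n q \<tau> k)" unfolding c_def by (rule Max_in) auto
      then obtain k where "c = \<mu> k + best_reply n q \<tau> k" by blast
      then have "c < v" using neg by (simp add: not_le)
      have "\<forall>k. \<mu> k + best_reply n q \<tau> k \<le> c" unfolding c_def by auto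
      then have "?f s \<tau> \<le> c" for s using guarantee_iff[of n \<mu> q \<tau> c] by (cases s) simp
      then have "(SUP s. ?f s \<tau>) \<le> c" by (intro cSUP_least) auto
      then show False using v[of \<tau>] \<open>c < v\<close> by linarith
    qed
    then show "\<exists>s. \<forall>\<tau>. v \<le> ?f s \<tau>"
      using ex_guarantee[of v \<mu> q n] unfolding payoff1_eq_dual_payoff by auto
  qed
  then show "has_value ?f (w1 G P Q n lam \<mu> q)" "w1 G P Q n lam \<mu> q = (INF \<tau>. SUP (p, \<sigma>). payoff1 G P Q n lam \<mu> p q \<sigma> \<tau>)"
    unfolding w1_def by (simp_all add: game_value_eqI split_def)
qed

lemma bdd_payoff1:
  "bdd_above (range (\<lambda>(p, \<sigma>). payoff1 G P Q n lam \<mu> p q \<sigma> \<tau>))"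
  "bdd_below (range (\<lambda>\<tau>. SUP (p, \<sigma>). payoff1 G P Q n lam \<mu> p q \<sigma> \<tau>))"
proof -
  obtain B where B: "\<And>p \<sigma> \<tau>. \<bar>payoff1 G P Q n lam \<mu> p q \<sigma> \<tau>\<bar> \<le> B" using payoff1_bounded by blast
  have b: "- B \<le> payoff1 G P Q n lam \<mu> p q \<sigma> \<tau>" "payoff1 G P Q n lam \<mu> p q \<sigma> \<tau> \<le> B" for p \<sigma> \<tau>
    using B[of p \<sigma> \<tau>] by auto
  show above: "bdd_above (range (\<lambda>(p, \<sigma>). payoff1 G P Q n lam \<mu> p q \<sigma> \<tau>))" for \<tau>
    using b by (intro bdd_aboveI2[of _ _ B]) auto
  show "bdd_below (range (\<lambda>\<tau>. SUP (p, \<sigma>). payoff1 G P Q n lam \<mu> p q \<sigma> \<tau>))"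
  proof (rule bdd_belowI2)
    fix \<tau>
    show "- B \<le> (SUP (p, \<sigma>). payoff1 G P Q n lam \<mu> p q \<sigma> \<tau>)"
      by (rule cSUP_upper2[OF above UNIV_I]) (auto simp: b split: prod.split)
  qed
qed

lemma w1_le:
  assumes "\<And>k. \<mu> k + best_reply n q \<tau> k \<le> c"
  shows "w1 G P Q n lam \<mu> q \<le> c"
proof -
  have "\<forall>p \<sigma>. payoff1 G P Q n lam \<mu> p q \<sigma> \<tau> \<le> c"
    unfolding guarantee_iff using assms by simp
  then have "(SUP (p, \<sigma>). payoff1 G P Q n lam \<mu> p q \<sigma> \<tau>) \<le> c" by (intro cSUP_least) (auto split: prod.split)
  then show ?thesis unfolding w1_eq by (rule cINF_lower2[OF bdd_payoff1(2) UNIV_I])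
qed

text \<open>The value is an infimum over \<open>\<tau>\<close>, and attainment is not established;
  an arbitrary error is enough to paste continuation strategies together.\<close>

lemma w1_approx:
  assumes "0 < e"
  shows "\<exists>\<tau>. \<forall>k. \<mu> k + best_reply n q \<tau> k \<le> w1 G P Q n lam \<mu> q + e"
proof -
  have "w1 G P Q n lam \<mu> q < w1 G P Q n lam \<mu> q + e" using assms by simp
  then obtain \<tau> where \<tau>: "(SUP (p, \<sigma>). payoff1 G P Q n lam \<mu> p q \<sigma> \<tau>) < w1 G P Q n lam \<mu> q + e"
    unfolding w1_eq by (subst (asm) cINF_less_iff) (auto simp: bdd_payoff1)
  have "\<forall>p \<sigma>. payoff1 G P Q n lam \<mu> p q \<sigma> \<tau> \<le> w1 G P Q n lam \<mu> q + e"
  proof (intro allI)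
    fix p \<sigma>
    show "payoff1 G P Q n lam \<mu> p q \<sigma> \<tau> \<le> w1 G P Q n lam \<mu> q + e"
      using cSUP_upper[OF UNIV_I bdd_payoff1(1)[of n \<mu> q \<tau>], of "(p, \<sigma>)"] \<tau> by simp
  qed
  then show ?thesis unfolding guarantee_iff by (rule exI[of _ \<tau>])
qed


subsection \<open>Splitting off the first stage\<close>

text \<open>After stage 1 the state \<open>k\<close> no longer affects payoffs or transitions, and
  player 1 never saw \<open>l\<close>, so \<open>l\<close> can be summed out. The factor
  \<open>lam\<close> compensates for the action history being one entry shorter.\<close>

lemma best_tail:
  assumes "length ks = Suc (length hs)"
  shows "best S m (k # ks) (h # hs) = best (\<lambda>ls hs b. lam * (\<Sum>l\<in>UNIV. S (l # ls) (h # hs) b)) m ks hs"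
  using assms
proof (induction m arbitrary: ks hs)
  case (Suc m)
  have "stage_cost S (k # ks) (h # hs) a =
      stage_cost (\<lambda>ls hs b. lam * (\<Sum>l\<in>UNIV. S (l # ls) (h # hs) b)) ks hs a" for a
  proof -
    have "ks \<noteq> []" using Suc.prems by auto
    have "stage_cost S (k # ks) (h # hs) a = (\<Sum>ls | length ls = Suc (length hs). \<Sum>l\<in>UNIV. \<Sum>b\<in>UNIV.
        S (l # ls) (h # hs) b * lam ^ Suc (length hs) * G (last ks) (last ls) a b)"
      unfolding stage_cost_def using \<open>ks \<noteq> []\<close>
      by (subst length_Cons, subst sum_lists_Cons) (auto intro!: sum.cong)
    also have "\<dots> = stage_cost (\<lambda>ls hs b. lam * (\<Sum>l\<in>UNIV. S (l # ls) (h # hs) b)) ks hs a"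
      unfolding stage_cost_def
      by (intro sum.cong refl, subst sum.swap) (simp add: sum_distrib_left sum_distrib_right mult_ac)
    finally show ?thesis .
  qed
  moreover have "last (k # ks) = last ks" using Suc.prems by auto
  moreover have "best S m ((k # ks) @ [k']) ((h # hs) @ [(a, b)]) =
     best (\<lambda>ls hs b. lam * (\<Sum>l\<in>UNIV. S (l # ls) (h # hs) b)) m (ks @ [k']) (hs @ [(a, b)])" for k' a b
    using Suc.IH[of "ks @ [k']" "hs @ [(a, b)]"] Suc.prems by simp
  ultimately show ?case unfolding best.simps by (simp only:)
qed simp

lemma best_scale:
  assumes "0 \<le> c"
  shows "best (\<lambda>ls hs b. c * S ls hs b) m ks hs = c * best S m ks hs"
proof (induction m arbitrary: ks hs)
  case (Suc m)
  define v where "v a = stage_cost S ks hs a + (\<Sum>k'\<in>UNIV. \<Sum>b\<in>UNIV. pmf (P a b (last ks)) k' *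
        best S m (ks @ [k']) (hs @ [(a, b)]))" for a
  have "stage_cost (\<lambda>ls hs b. c * S ls hs b) ks hs a = c * stage_cost S ks hs a" for a
    by (simp add: stage_cost_def sum_distrib_left mult.assoc)
  then have "best (\<lambda>ls hs b. c * S ls hs b) (Suc m) ks hs = (MAX a. c * v a)"
    unfolding best.simps Suc.IH
    by (simp add: v_def distrib_left sum_distrib_left mult.left_commute)
  also have "\<dots> = c * (MAX a. v a)"
    using mono_Max_commute[of "\<lambda>x. c * x" "range v"] assms
    by (simp add: mono_def mult_left_mono image_image)
  also have "(MAX a. v a) = best S (Suc m) ks hs" by (simp add: v_def)
  finally show ?case .
qed simp

text \<open>\<open>y\<close> is the probability of player 2's first action. Positive homogeneity of
  \<open>best\<close> takes it outside, so \<open>y = 0\<close> needs no separate treatment.\<close>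

lemma best_continuation:
  assumes "\<And>ls hs b'. length ls = Suc (length hs) \<Longrightarrow> length ls \<le> m \<Longrightarrow>
      (\<Sum>l\<in>UNIV. weights (pmf q) \<tau> (l # ls) (h # hs) b') = y * weights (pmf q') \<tau>' ls hs b'"
    and "0 \<le> y"
  shows "best (weights (pmf q) \<tau>) m [k, k'] [h] = lam * y * best_reply m q' \<tau>' k'"
proof -
  have "best (weights (pmf q) \<tau>) m [k, k'] [h] =
      best (\<lambda>ls hs b. lam * (\<Sum>l\<in>UNIV. weights (pmf q) \<tau> (l # ls) (h # hs) b)) m [k'] []"
    by (rule best_tail) simp
  also have "\<dots> = best (\<lambda>ls hs b. (lam * y) * weights (pmf q') \<tau>' ls hs b) m [k'] []"
    by (rule best_cong) (simp add: assms(1))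
  also have "\<dots> = lam * y * best_reply m q' \<tau>' k'"
    by (rule best_scale) (simp add: lam_nonneg assms(2))
  finally show ?thesis .
qed

lemma stage_cost_first:
  "stage_cost (weights (pmf q) \<tau>) [k] [] a =
    (\<Sum>l\<in>UNIV. \<Sum>b\<in>UNIV. G k l a b * pmf (\<tau> [l] []) b * pmf q l)"
  by (simp add: stage_cost_def sum_lists_one weights_def mult_ac)

lemma action_prob_nonneg: "0 \<le> action_prob q Y b"
  unfolding action_prob_def by (intro sum_nonneg) auto

lemma sum_action_prob:
  "(\<Sum>l\<in>UNIV. \<Sum>b\<in>UNIV. pmf (Y l) b * pmf q l * f b) = (\<Sum>b\<in>UNIV. action_prob q Y b * f b)"
  unfolding action_prob_def sum_distrib_right by (subst sum.swap) (simp add: mult_ac)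

text \<open>Bayes' rule with the denominator multiplied out. It survives a zero denominator, where
  \<open>q'\<close> is arbitrary, because every summand on the left vanishes too.\<close>

lemma belief_update_scaled:
  assumes "belief_update T q Y b q'"
  shows "(\<Sum>l\<in>UNIV. pmf q l * pmf (Y l) b * pmf (T l) l') = action_prob q Y b * pmf q' l'"
proof (cases "action_prob q Y b = 0")
  case True
  then have "pmf q l * pmf (Y l) b = 0" for l
    unfolding action_prob_def by (subst (asm) sum_nonneg_eq_0_iff) auto
  then show ?thesis unfolding True by (simp only: mult_zero_left sum.neutral_const)
next
  case False
  then have "pmf q' l' = (\<Sum>l\<in>UNIV. pmf (T l) l' * (pmf q l * pmf (Y l) b / action_prob q Y b))"
    using assms by (simp add: belief_update_def)
  then show ?thesis using False by (simp add: sum_distrib_left mult_ac)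
qed

text \<open>The bound on player 1's payoff from choosing \<open>a\<close> in state \<open>k\<close> at stage 1, when player 2
  plays \<open>Y\<close> and then guarantees at most \<open>w a b\<close> in the continuation with vector payoff \<open>\<beta> a b\<close>.\<close>

definition entry ::
  "('k \<Rightarrow> real) \<Rightarrow> 'l pmf \<Rightarrow> ('l \<Rightarrow> 'b pmf) \<Rightarrow> ('a \<Rightarrow> 'b \<Rightarrow> real) \<Rightarrow> ('a \<Rightarrow> 'b \<Rightarrow> 'k \<Rightarrow> real) \<Rightarrow>
   'a \<Rightarrow> 'k \<Rightarrow> real" where
  "entry \<mu> q Y w \<beta> a k = \<mu> k + (\<Sum>l\<in>UNIV. \<Sum>b\<in>UNIV. G k l a b * pmf (Y l) b * pmf q l)
     + lam * (\<Sum>b\<in>UNIV. action_prob q Y b * (w a b - (\<Sum>k'\<in>UNIV. pmf (P a b k) k' * \<beta> a b k')))"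

lemma entry_mono:
  assumes "\<And>a b. w a b \<le> w' a b"
  shows "entry \<mu> q Y w \<beta> a k \<le> entry \<mu> q Y w' \<beta> a k"
  unfolding entry_def
  by (intro add_left_mono mult_left_mono sum_mono diff_right_mono assms lam_nonneg action_prob_nonneg)

lemma vector_objective1_le_iff:
  "vector_objective1 G P Q n lam \<mu> q qplus Y \<beta> \<le> c \<longleftrightarrow>
    (\<forall>a k. entry \<mu> q Y (\<lambda>a b. w1 G P Q (n - 1) lam (\<beta> a b) (qplus Y a b)) \<beta> a k \<le> c)"
  unfolding vector_objective1_def entry_def by (rule SUP_pmf_pair_le_iff)

text \<open>With bound 0 and vector payoff \<open>- v\<close>, \<open>entry\<close> is no longer
  just a bound but player 1's exact payoff: the term with \<open>P\<close> becomes the expected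
  \<open>v\<close> at the next state.\<close>

lemma best_reply_entry_eq:
  assumes "\<And>l. Y l = \<tau> [l] []"
    and "\<And>a b k'. best (weights (pmf q) \<tau>) m [k, k'] [(a, b)] = lam * action_prob q Y b * v a b k'"
  shows "\<mu> k + (stage_cost (weights (pmf q) \<tau>) [k] [] a + (\<Sum>k'\<in>UNIV. \<Sum>b\<in>UNIV. pmf (P a b (last [k])) k' *
     best (weights (pmf q) \<tau>) m ([k] @ [k']) ([] @ [(a, b)]))) = entry \<mu> q Y (\<lambda>a b. 0) (\<lambda>a b k. - v a b k) a k"
proof -
  have "(\<Sum>k'\<in>UNIV. \<Sum>b\<in>UNIV. pmf (P a b (last [k])) k' *
     best (weights (pmf q) \<tau>) m ([k] @ [k']) ([] @ [(a, b)])) =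
     (\<Sum>b\<in>UNIV. \<Sum>k'\<in>UNIV. lam * (action_prob q Y b * (pmf (P a b k) k' * v a b k')))"
    by (subst sum.swap) (simp add: assms(2) mult_ac)
  then show ?thesis
    unfolding entry_def stage_cost_first assms(1)[symmetric]
    by (simp add: sum_distrib_left sum_negf)
qed


subsection \<open>The recursive formula and the linear program\<close>

text \<open>Player 2 can play \<open>Y\<close> and then a nearly optimal strategy of the dual game
  with vector payoff \<open>\<beta> a b\<close> and prior \<open>qplus Y a b\<close>. Averaging its
  guarantee over the next state of player 1 gives the entries of the vector objective, up to the
  error.\<close>

lemma w1_le_vector_objective1:
  assumes "lam \<le> 1"
    and belief: "\<And>a b. belief_update (Q a b) q Y b (qplus Y a b)"
  shows "w1 G P Q (Suc m) lam \<mu> q \<le> vector_objective1 G P Q (Suc m) lam \<mu> q qplus Y \<beta>"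
proof (rule field_le_epsilon)
  fix e :: real
  assume "0 < e"
  let ?w = "\<lambda>a b. w1 G P Q m lam (\<beta> a b) (qplus Y a b)"
  have "\<exists>T. \<forall>a b. \<forall>k. \<beta> a b k + best_reply m (qplus Y a b) (T a b) k \<le> ?w a b + e"
    by (intro choice allI) (rule w1_approx[OF \<open>0 < e\<close>])
  then obtain T where T: "\<And>a b k. \<beta> a b k + best_reply m (qplus Y a b) (T a b) k \<le> ?w a b + e"
    by blast
  \<comment> \<open>The continuation forgets the initial state and restarts; what that state
    revealed is contained in the belief \<open>qplus Y a b\<close>.\<close>
  define \<tau> :: "('l, 'a, 'b, 'b) strategy" where
    "\<tau> ls hs = (case hs of [] \<Rightarrow> Y (hd ls) | (a, b) # hs' \<Rightarrow> T a b (tl ls) hs')" for ls hs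
  \<comment> \<open>Summing out the initial state leaves the reach weights of a fresh game that
    starts from the updated belief, scaled by the probability of \<open>b\<close>.\<close>
  have reach: "(\<Sum>l\<in>UNIV. reach (pmf q) \<tau> (l # ls) ((a, b) # hs)) =
      action_prob q Y b * reach (pmf (qplus Y a b)) (T a b) ls hs"
    if "length ls = Suc (length hs)" for a b ls hs
    using that
  proof (induction rule: info_induct)
    case (Nil l')
    have "reach (pmf q) \<tau> [l, l'] [(a, b)] = pmf q l * pmf (Y l) b * pmf (Q a b l) l'" for l
      using reach_snoc[of "[l]" "[]" "pmf q" \<tau> l' a b] by (simp add: weights_def \<tau>_def)
    then show ?case using belief_update_scaled[OF belief] by simp
  next
    case (snoc ls hs a' b' l')
    then have "ls \<noteq> []" by auto
    have "reach (pmf q) \<tau> (l # ls @ [l']) ((a, b) # hs @ [(a', b')]) =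
        reach (pmf q) \<tau> (l # ls) ((a, b) # hs) * (pmf (T a b ls hs) b' * pmf (Q a' b' (last ls)) l')" for l
      using reach_snoc[of "l # ls" "(a, b) # hs" "pmf q" \<tau> l' a' b'] snoc.hyps \<open>ls \<noteq> []\<close>
      by (simp add: weights_def \<tau>_def)
    then show ?case
      using snoc by (simp add: reach_snoc weights_def mult.assoc flip: sum_distrib_right)
  qed
  have cont: "best (weights (pmf q) \<tau>) m [k, k'] [(a, b)] =
      lam * action_prob q Y b * best_reply m (qplus Y a b) (T a b) k'" for k k' a b
  proof (rule best_continuation)
    fix ls :: "'l list" and hs :: "('a \<times> 'b) list" and b'
    assume "length ls = Suc (length hs)"
    then show "(\<Sum>l\<in>UNIV. weights (pmf q) \<tau> (l # ls) ((a, b) # hs) b') =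
        action_prob q Y b * weights (pmf (qplus Y a b)) (T a b) ls hs b'"
      unfolding weights_def by (simp add: \<tau>_def reach mult.assoc flip: sum_distrib_right)
  qed (rule action_prob_nonneg)
  show "w1 G P Q (Suc m) lam \<mu> q \<le> vector_objective1 G P Q (Suc m) lam \<mu> q qplus Y \<beta> + e"
  proof (rule w1_le)
    fix k
    have "\<mu> k + (stage_cost (weights (pmf q) \<tau>) [k] [] a + (\<Sum>k'\<in>UNIV. \<Sum>b\<in>UNIV. pmf (P a b (last [k])) k' *
        best (weights (pmf q) \<tau>) m ([k] @ [k']) ([] @ [(a, b)]))) \<le>
        vector_objective1 G P Q (Suc m) lam \<mu> q qplus Y \<beta> + e" for a
    proof -
      let ?v = "\<lambda>a b k'. best_reply m (qplus Y a b) (T a b) k'"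
      have "\<mu> k + (stage_cost (weights (pmf q) \<tau>) [k] [] a + (\<Sum>k'\<in>UNIV. \<Sum>b\<in>UNIV. pmf (P a b (last [k])) k' *
          best (weights (pmf q) \<tau>) m ([k] @ [k']) ([] @ [(a, b)]))) = entry \<mu> q Y (\<lambda>a b. 0) (\<lambda>a b k. - ?v a b k) a k"
        by (rule best_reply_entry_eq) (simp add: \<tau>_def, rule cont)
      \<comment> \<open>The error enters only the continuation, hence discounted, and the action
        probabilities sum to 1.\<close>
      also have "\<dots> \<le> entry \<mu> q Y ?w \<beta> a k + lam * e"
      proof -
        have "- (\<Sum>k'\<in>UNIV. pmf (P a b k) k' * - ?v a b k') \<le>
            ?w a b - (\<Sum>k'\<in>UNIV. pmf (P a b k) k' * \<beta> a b k') + e" for b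
        proof -
          have "(\<Sum>k'\<in>UNIV. pmf (P a b k) k' * (\<beta> a b k' + ?v a b k')) \<le> ?w a b + e"
            by (rule pmf_weighted_le) (rule T)
          then show ?thesis by (simp add: distrib_left sum.distrib sum_negf)
        qed
        then have "(\<Sum>b\<in>UNIV. action_prob q Y b * (0 - (\<Sum>k'\<in>UNIV. pmf (P a b k) k' * - ?v a b k'))) \<le>
            (\<Sum>b\<in>UNIV. action_prob q Y b * (?w a b - (\<Sum>k'\<in>UNIV. pmf (P a b k) k' * \<beta> a b k') + e))"
          by (intro sum_mono mult_left_mono action_prob_nonneg) simp
        also have "\<dots> = (\<Sum>b\<in>UNIV. action_prob q Y b * (?w a b - (\<Sum>k'\<in>UNIV. pmf (P a b k) k' * \<beta> a b k')))
            + (\<Sum>b\<in>UNIV. action_prob q Y b) * e"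
          by (simp only: distrib_left sum.distrib sum_distrib_right)
        also have "(\<Sum>b\<in>UNIV. action_prob q Y b) = 1"
          unfolding action_prob_def
          by (subst sum.swap) (simp add: sum_pmf_eq_1 flip: sum_distrib_left)
        finally show ?thesis
          unfolding entry_def using mult_left_mono[OF _ lam_nonneg] by (fastforce simp: distrib_left)
      qed
      also have "\<dots> \<le> vector_objective1 G P Q (Suc m) lam \<mu> q qplus Y \<beta> + e"
      proof (rule add_mono)
        show "entry \<mu> q Y ?w \<beta> a k \<le> vector_objective1 G P Q (Suc m) lam \<mu> q qplus Y \<beta>"
          using vector_objective1_le_iff[of "Suc m" \<mu> q qplus Y \<beta>] by auto
        show "lam * e \<le> e" using assms(1) \<open>0 < e\<close> by simp
      qed
      finally show ?thesis .
    qed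
    then have "best_reply (Suc m) q \<tau> k \<le> vector_objective1 G P Q (Suc m) lam \<mu> q qplus Y \<beta> + e - \<mu> k"
      by (intro best_le) (simp add: algebra_simps)
    then show "\<mu> k + best_reply (Suc m) q \<tau> k \<le> vector_objective1 G P Q (Suc m) lam \<mu> q qplus Y \<beta> + e"
      by linarith
  qed
qed

text \<open>For each \<open>(a, b)\<close>, \<open>S\<close> is realized by a continuation strategy
  and \<open>Z\<close> dominates player 1's best reply to it, so that strategy guarantees
  \<open>Z0 a b\<close>. Replacing \<open>Z0\<close> by the smaller continuation value only lowers
  the entries.\<close>

lemma vector_objective1_le_lp1:
  assumes "lp1_feasible G P Q (Suc m) lam \<mu> q Y (qplus Y) \<rho> Z0 Z S \<beta>"
  shows "vector_objective1 G P Q (Suc m) lam \<mu> q qplus Y \<beta> \<le> \<rho>"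
proof -
  note F = assms[unfolded lp1_feasible_def sum_action_prob diff_Suc_1]
  have rho: "entry \<mu> q Y Z0 \<beta> a k \<le> \<rho>" for a k
    unfolding entry_def using F[THEN conjunct1, rule_format] .
  have beta: "\<beta> a b k + Z a b [k] [] \<le> Z0 a b" for a b k
    using F[THEN conjunct2, THEN conjunct1, rule_format] .
  note F' = F[THEN conjunct2, THEN conjunct2, THEN conjunct2]
  have plan: "plan (pmf (qplus Y a b)) m (S a b)" for a b
    unfolding plan_def using F' by simp
  have zero: "Z a b ks hs = 0" if "is_info (Suc m) ks hs" for a b ks hs
    using F' that by simp
  have Z: "stage_cost (S a b) ks hs as +
      (\<Sum>k'\<in>UNIV. \<Sum>bs\<in>UNIV. pmf (P as bs (last ks)) k' * Z a b (ks @ [k']) (hs @ [(as, bs)])) \<le> Z a b ks hs"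
    if "length ks = Suc (length hs)" "length ks \<le> m" for a b ks hs as
  proof -
    have "length ks \<in> {1..Suc m - 1}" "is_info (length ks) ks hs" using that by (auto simp: is_info_def)
    then have "(\<Sum>ls | length ls = length ks. \<Sum>bs\<in>UNIV.
           S a b ls hs bs * lam ^ (length ks - 1) * G (last ks) (last ls) as bs)
        + (\<Sum>k'\<in>UNIV. \<Sum>bs\<in>UNIV. pmf (P as bs (last ks)) k' * Z a b (ks @ [k']) (hs @ [(as, bs)]))
        \<le> Z a b ks hs"
      using assms[unfolded lp1_feasible_def, THEN conjunct2, THEN conjunct2, THEN conjunct1, rule_format]
      by blast
    then show ?thesis using that by (simp add: stage_cost_def)
  qed
  \<comment> \<open>Backward induction from length \<open>Suc m\<close>, the horizon of the full
    game, where \<open>Z\<close> is 0. Starting from length 1 leaves the \<open>m\<close> stages of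
    the continuation.\<close>
  have best_le_Z: "best (S a b) j ks hs \<le> Z a b ks hs"
    if "length ks = Suc (length hs)" "length ks + j = Suc m" for a b j ks hs
    using that
  proof (induction j arbitrary: ks hs)
    case 0
    then show ?case by (simp add: zero is_info_def)
  next
    case (Suc j)
    have "best (S a b) (Suc j) ks hs \<le> Z a b ks hs"
    proof (rule best_le)
      fix as
      have "(\<Sum>k'\<in>UNIV. \<Sum>bs\<in>UNIV. pmf (P as bs (last ks)) k' * best (S a b) j (ks @ [k']) (hs @ [(as, bs)])) \<le>
          (\<Sum>k'\<in>UNIV. \<Sum>bs\<in>UNIV. pmf (P as bs (last ks)) k' * Z a b (ks @ [k']) (hs @ [(as, bs)]))"
        by (intro sum_mono mult_left_mono Suc.IH) (use Suc.prems in auto)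
      then show "stage_cost (S a b) ks hs as + (\<Sum>k'\<in>UNIV. \<Sum>bs\<in>UNIV. pmf (P as bs (last ks)) k' *
          best (S a b) j (ks @ [k']) (hs @ [(as, bs)])) \<le> Z a b ks hs"
        using Z[of ks hs a b as] Suc.prems by linarith
    qed
    then show ?case .
  qed
  have "w1 G P Q m lam (\<beta> a b) (qplus Y a b) \<le> Z0 a b" for a b
  proof -
    obtain \<tau> where \<tau>: "\<And>s ls hs b'. is_info s ls hs \<Longrightarrow> s \<le> m \<Longrightarrow>
        S a b ls hs b' = weights (pmf (qplus Y a b)) \<tau> ls hs b'"
      using plan_realized[OF plan] by blast
    show ?thesis
    proof (rule w1_le)
      fix k
      have "best_reply m (qplus Y a b) \<tau> k = best (S a b) m [k] []"
        by (rule best_cong) (simp add: \<tau>[symmetric] is_info_def)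
      then show "\<beta> a b k + best_reply m (qplus Y a b) \<tau> k \<le> Z0 a b"
        using best_le_Z[of "[k]" "[]" m a b] beta[of a b k] by simp
    qed
  qed
  then show ?thesis
    unfolding vector_objective1_le_iff diff_Suc_1
    by (intro allI order_trans[OF entry_mono rho])
qed

lemma lp1_feasible_of_optimal:
  assumes "optimal_stage1_player2 G P Q (Suc m) lam \<mu> q Y"
    and belief: "\<And>a b. belief_update (Q a b) q Y b (q' a b)"
  shows "\<exists>Z0 Z S \<beta>. lp1_feasible G P Q (Suc m) lam \<mu> q Y q' (w1 G P Q (Suc m) lam \<mu> q) Z0 Z S \<beta>"
proof -
  obtain \<tau> where \<tau>: "\<And>k. \<mu> k + best_reply (Suc m) q \<tau> k \<le> w1 G P Q (Suc m) lam \<mu> q"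
    and Y: "\<And>l. Y l = \<tau> [l] []"
    using assms(1) unfolding optimal_stage1_player2_def guarantee_iff by blast
  have "\<exists>\<tau>'. \<forall>s ls hs b'. is_info s ls hs \<longrightarrow> s \<le> m \<longrightarrow>
      (\<Sum>l\<in>UNIV. weights (pmf q) \<tau> (l # ls) ((a, b) # hs) b') =
      action_prob q Y b * weights (pmf (q' a b)) \<tau>' ls hs b'" for a b
  proof -
    \<comment> \<open>Before normalization, the continuation weights form a plan with initial vector
      \<open>action_prob q Y b * pmf (q' a b) l'\<close>. Realizing it and pulling out the factor
      gives a strategy for the prior \<open>q' a b\<close>.\<close>
    have "plan (\<lambda>l'. action_prob q Y b * pmf (q' a b) l') m
        (\<lambda>ls hs b'. \<Sum>l\<in>UNIV. weights (pmf q) \<tau> (l # ls) ((a, b) # hs) b')"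
      unfolding plan_def
    proof (intro conjI allI ballI impI)
      fix l'
      have "reach (pmf q) \<tau> [l, l'] [(a, b)] = pmf q l * pmf (Y l) b * pmf (Q a b l) l'" for l
        using reach_snoc[of "[l]" "[]" "pmf q" \<tau> l' a b] by (simp add: weights_def Y)
      then show "(\<Sum>b'\<in>UNIV. \<Sum>l\<in>UNIV. weights (pmf q) \<tau> [l, l'] [(a, b)] b') =
          action_prob q Y b * pmf (q' a b) l'"
        using belief_update_scaled[OF belief] by (subst sum.swap) (simp add: sum_weights)
    next
      fix t and ls :: "'l list" and hs :: "('a \<times> 'b) list" and a' b' l'
      assume "is_info (t - 1) ls hs"
      then have "length ls = Suc (length hs)" "ls \<noteq> []" by (auto simp: is_info_def)
      then have "reach (pmf q) \<tau> (l # ls @ [l']) ((a, b) # hs @ [(a', b')]) =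
          weights (pmf q) \<tau> (l # ls) ((a, b) # hs) b' * pmf (Q a' b' (last ls)) l'" for l
        using reach_snoc[of "l # ls" "(a, b) # hs" "pmf q" \<tau> l' a' b'] by simp
      then show "(\<Sum>b''\<in>UNIV. \<Sum>l\<in>UNIV. weights (pmf q) \<tau> (l # ls @ [l']) ((a, b) # hs @ [(a', b')]) b'') =
          pmf (Q a' b' (last ls)) l' * (\<Sum>l\<in>UNIV. weights (pmf q) \<tau> (l # ls) ((a, b) # hs) b')"
        by (subst sum.swap) (simp add: sum_weights sum_distrib_left mult.commute)
    qed (auto intro!: sum_nonneg weights_nonneg)
    then show ?thesis by (rule plan_realized) (auto simp: weights_scale)
  qed
  then obtain T where T: "\<And>a b s ls hs b'. is_info s ls hs \<Longrightarrow> s \<le> m \<Longrightarrow>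
      (\<Sum>l\<in>UNIV. weights (pmf q) \<tau> (l # ls) ((a, b) # hs) b') =
      action_prob q Y b * weights (pmf (q' a b)) (T a b) ls hs b'"
    by metis
  let ?v = "\<lambda>a b k'. best_reply m (q' a b) (T a b) k'"
  have cont: "best (weights (pmf q) \<tau>) m [k, k'] [(a, b)] = lam * action_prob q Y b * ?v a b k'" for k k' a b
    by (rule best_continuation) (auto simp: T is_info_def action_prob_nonneg)
  \<comment> \<open>Built from the normalized prior, so that the initial constraint on
    \<open>S\<close> also holds for actions \<open>b\<close> of probability 0, where the summed
    continuation weights vanish.\<close>
  define S where "S a b = weights (pmf (q' a b)) (T a b)" for a b
  define Z where "Z a b ks hs = best (S a b) (Suc m - length ks) ks hs" for a b ks hs
  have "lp1_feasible G P Q (Suc m) lam \<mu> q Y q' (w1 G P Q (Suc m) lam \<mu> q) (\<lambda>a b. 0) Z S (\<lambda>a b k. - ?v a b k)"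
    unfolding lp1_feasible_def sum_action_prob
  proof (intro conjI allI ballI impI)
    fix a k
    have "entry \<mu> q Y (\<lambda>a b. 0) (\<lambda>a b k. - ?v a b k) a k =
        \<mu> k + (stage_cost (weights (pmf q) \<tau>) [k] [] a + (\<Sum>k'\<in>UNIV. \<Sum>b\<in>UNIV. pmf (P a b (last [k])) k' *
          best (weights (pmf q) \<tau>) m ([k] @ [k']) ([] @ [(a, b)])))"
      by (rule best_reply_entry_eq[symmetric]) (rule Y, rule cont)
    also have "\<dots> \<le> \<mu> k + best_reply (Suc m) q \<tau> k" by (intro add_left_mono best_ge)
    also have "\<dots> \<le> w1 G P Q (Suc m) lam \<mu> q" by (rule \<tau>)
    finally show "\<mu> k + (\<Sum>l\<in>UNIV. \<Sum>b\<in>UNIV. G k l a b * pmf (Y l) b * pmf q l) +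
        lam * (\<Sum>b\<in>UNIV. action_prob q Y b * (0 - (\<Sum>k'\<in>UNIV. pmf (P a b k) k' * - ?v a b k')))
        \<le> w1 G P Q (Suc m) lam \<mu> q"
      by (simp only: entry_def)
  next
    fix a b s and ks :: "'k list" and hs :: "('a \<times> 'b) list" and as
    assume "s \<in> {1..Suc m - 1}" "is_info s ks hs"
    then have s: "length ks = s" "Suc (length hs) = s" "Suc m - s = Suc (Suc m - Suc s)" "s - 1 = length hs"
      by (auto simp: is_info_def)
    have "stage_cost (S a b) ks hs as + (\<Sum>k'\<in>UNIV. \<Sum>bs\<in>UNIV. pmf (P as bs (last ks)) k' *
        best (S a b) (Suc m - Suc s) (ks @ [k']) (hs @ [(as, bs)])) \<le> best (S a b) (Suc (Suc m - Suc s)) ks hs"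
      by (rule best_ge)
    then show "(\<Sum>ls | length ls = s. \<Sum>bs\<in>UNIV. S a b ls hs bs * lam ^ (s - 1) * G (last ks) (last ls) as bs)
        + (\<Sum>k'\<in>UNIV. \<Sum>bs\<in>UNIV. pmf (P as bs (last ks)) k' * Z a b (ks @ [k']) (hs @ [(as, bs)]))
        \<le> Z a b ks hs"
      unfolding Z_def stage_cost_def s(1) s(2)[symmetric] using s by simp
  next
    show "- ?v a b k + Z a b [k] [] \<le> 0" for a b k by (simp add: Z_def S_def)
    show "Z a b ks hs = 0" if "is_info (Suc m) ks hs" for a b ks hs
      using that by (simp add: Z_def is_info_def)
    have plan: "plan (pmf (q' a b)) m (S a b)" for a b
      unfolding S_def by (rule plan_weights) simp
    show "(\<Sum>b1\<in>UNIV. S a b [l] [] b1) = pmf (q' a b) l" for a b l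
      using plan unfolding plan_def by blast
    show "0 \<le> S a b ls hs bt" if "t \<in> {1..Suc m - 1}" "is_info t ls hs" for a b t ls hs bt
      using plan that unfolding plan_def diff_Suc_1 by blast
    show "(\<Sum>bt\<in>UNIV. S a b (ls @ [l']) (hs @ [(a', b')]) bt) = pmf (Q a' b' (last ls)) l' * S a b ls hs b'"
      if "t \<in> {2..Suc m - 1}" "is_info (t - 1) ls hs" for a b t ls hs a' b' l'
      using plan that unfolding plan_def diff_Suc_1 by blast
  qed
  then show ?thesis by blast
qed

text \<open>A sandwich: the value is below every vector objective, the objective at
  \<open>(Y, \<beta>)\<close> is below \<open>\<rho>\<close> for every feasible point, and some
  feasible point has \<open>\<rho>\<close> equal to the value. At an optimal solution all three
  agree, so \<open>(Y, \<beta>)\<close> minimizes jointly.\<close>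

theorem lp1_correct:
  assumes "1 \<le> n" "lam \<le> 1"
    and opt: "optimal_stage1_player2 G P Q n lam \<mu> q Y"
    and belief: "\<And>Y' a b. belief_update (Q a b) q Y' b (qplus Y' a b)"
  shows "\<exists>Z0 Z S \<beta>. lp1_optimal G P Q n lam \<mu> q Y (qplus Y) (w1 G P Q n lam \<mu> q) Z0 Z S \<beta>"
    and "lp1_optimal G P Q n lam \<mu> q Y (qplus Y) \<rho> Z0 Z S \<beta> \<Longrightarrow>
      solves_vector_problem1 G P Q n lam \<mu> q qplus Y \<beta>"
proof -
  obtain m where n: "n = Suc m" using assms(1) by (cases n) auto
  let ?w = "w1 G P Q n lam \<mu> q"
  have lower: "?w \<le> vector_objective1 G P Q n lam \<mu> q qplus Y' \<beta>'" for Y' \<beta>'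
    unfolding n by (rule w1_le_vector_objective1) (rule assms belief)+
  have upper: "vector_objective1 G P Q n lam \<mu> q qplus Y \<beta>' \<le> \<rho>'"
    if "lp1_feasible G P Q n lam \<mu> q Y (qplus Y) \<rho>' Z0' Z' S' \<beta>'" for \<rho>' Z0' Z' S' \<beta>'
    using that unfolding n by (rule vector_objective1_le_lp1)
  obtain Z0' Z' S' \<beta>' where feas: "lp1_feasible G P Q n lam \<mu> q Y (qplus Y) ?w Z0' Z' S' \<beta>'"
    using lp1_feasible_of_optimal opt belief unfolding n by blast
  then show "\<exists>Z0 Z S \<beta>. lp1_optimal G P Q n lam \<mu> q Y (qplus Y) ?w Z0 Z S \<beta>"
    unfolding lp1_optimal_def using order_trans[OF lower upper] by blast
  assume "lp1_optimal G P Q n lam \<mu> q Y (qplus Y) \<rho> Z0 Z S \<beta>"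
  then have "vector_objective1 G P Q n lam \<mu> q qplus Y \<beta> \<le> \<rho>" "\<rho> \<le> ?w"
    using upper feas unfolding lp1_optimal_def by blast+
  then show "solves_vector_problem1 G P Q n lam \<mu> q qplus Y \<beta>"
    unfolding solves_vector_problem1_def using lower by (meson order_antisym order_trans)
qed

end

subsection \<open>Exchanging the players\<close>

text \<open>In the exchanged game the action pairs are recorded in the opposite order, so a strategy
  must swap them before consulting its original self.\<close>

definition mirror :: "('s, 'a, 'b, 'c) strategy \<Rightarrow> ('s, 'b, 'a, 'c) strategy" where
  "mirror \<tau> ss hs = \<tau> ss (map prod.swap hs)"

lemma mirror_mirror [simp]: "mirror (mirror \<tau>) = \<tau>"
  by (simp add: mirror_def fun_eq_iff)

lemma bij_mirror: "bij mirror"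
  by (rule bij_betw_byWitness[of _ mirror]) auto

text \<open>Swapping the pairs is an involution on histories; this identifies constraints of the two
  programs that quantify over differently ordered pairs.\<close>

lemma all_mirrored: "(\<forall>hs. R (map prod.swap hs)) \<longleftrightarrow> (\<forall>hs. R hs)"
proof
  assume *: "\<forall>hs. R (map prod.swap hs)"
  show "\<forall>hs. R hs"
  proof
    fix hs
    show "R hs" using *[rule_format, of "map prod.swap hs"] by simp
  qed
qed simp

lemma is_info_mirrored [simp]: "is_info t ss (map f hs) = is_info t ss hs"
  by (simp add: is_info_def)

text \<open>Given the history, the two actions are drawn independently, and given the actions so are
  the two new states; exchanging the order within each pair changes nothing.\<close>

lemma stage_mirror:
  "stage (\<lambda>b a. Q a b) (\<lambda>b a. P a b) (mirror \<tau>) (mirror \<sigma>) (ls, ks, map prod.swap hs) =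
    map_pmf (\<lambda>(ks, ls, hs). (ls, ks, map prod.swap hs)) (stage P Q \<sigma> \<tau> (ks, ls, hs))"
proof -
  have "stage (\<lambda>b a. Q a b) (\<lambda>b a. P a b) (mirror \<tau>) (mirror \<sigma>) (ls, ks, map prod.swap hs) =
      do {b \<leftarrow> \<tau> ls hs; a \<leftarrow> \<sigma> ks hs; l' \<leftarrow> Q a b (last ls); k' \<leftarrow> P a b (last ks);
        return_pmf (ls @ [l'], ks @ [k'], map prod.swap (hs @ [(a, b)]))}"
    by (simp add: stage_def mirror_def)
  also have "\<dots> = do {a \<leftarrow> \<sigma> ks hs; b \<leftarrow> \<tau> ls hs; l' \<leftarrow> Q a b (last ls); k' \<leftarrow> P a b (last ks);
        return_pmf (ls @ [l'], ks @ [k'], map prod.swap (hs @ [(a, b)]))}"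
    by (rule bind_commute_pmf)
  also have "\<dots> = do {a \<leftarrow> \<sigma> ks hs; b \<leftarrow> \<tau> ls hs; k' \<leftarrow> P a b (last ks); l' \<leftarrow> Q a b (last ls);
        return_pmf (ls @ [l'], ks @ [k'], map prod.swap (hs @ [(a, b)]))}"
    by (intro bind_pmf_cong refl bind_commute_pmf)
  finally show ?thesis by (simp add: stage_def map_bind_pmf)
qed

lemma play_mirror:
  "play (\<lambda>b a. Q a b) (\<lambda>b a. P a b) q p (mirror \<tau>) (mirror \<sigma>) n =
    map_pmf (\<lambda>(ks, ls, hs). (ls, ks, map prod.swap hs)) (play P Q p q \<sigma> \<tau> n)"
proof (induction n)
  case 0
  show ?case by (simp add: map_bind_pmf) (rule bind_commute_pmf)
next
  case (Suc n)
  have "play (\<lambda>b a. Q a b) (\<lambda>b a. P a b) q p (mirror \<tau>) (mirror \<sigma>) (Suc n) =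
      play P Q p q \<sigma> \<tau> n \<bind> (\<lambda>(ks, ls, hs).
        stage (\<lambda>b a. Q a b) (\<lambda>b a. P a b) (mirror \<tau>) (mirror \<sigma>) (ls, ks, map prod.swap hs))"
    by (simp add: Suc.IH bind_map_pmf split_def)
  then show ?case by (simp add: stage_mirror map_bind_pmf split_def)
qed

lemma payoff2_mirror:
  fixes G :: "'k::finite \<Rightarrow> 'l::finite \<Rightarrow> 'a::finite \<Rightarrow> 'b::finite \<Rightarrow> real"
  shows "payoff2 G P Q n lam \<nu> p q \<sigma> \<tau> =
    - payoff1 (\<lambda>l k b a. - G k l a b) (\<lambda>b a. Q a b) (\<lambda>b a. P a b) n lam (\<lambda>l. - \<nu> l) q p (mirror \<tau>) (mirror \<sigma>)"
proof -
  have "payoff1 (\<lambda>l k b a. - G k l a b) (\<lambda>b a. Q a b) (\<lambda>b a. P a b) n lam (\<lambda>l. - \<nu> l) q p (mirror \<tau>) (mirror \<sigma>) =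
      measure_pmf.expectation (play P Q p q \<sigma> \<tau> n) (\<lambda>(ks, ls, hs). - \<nu> (hd ls) +
        total_payoff (\<lambda>l k b a. - G k l a b) n lam ls ks (map prod.swap hs))"
    by (simp add: payoff1_def play_mirror split_def)
  also have "\<dots> = measure_pmf.expectation (play P Q p q \<sigma> \<tau> n)
      (\<lambda>h. - (case h of (ks, ls, hs) \<Rightarrow> \<nu> (hd ls) + total_payoff G n lam ks ls hs))"
  \<comment> \<open>The integrands are compared only on the support, where \<open>hs\<close> has
    length \<open>n\<close>: reading entry \<open>t\<close> of the swapped list requires
    \<open>t\<close> to be in range.\<close>
  proof (rule integral_cong_AE)
    show "AE h in measure_pmf (play P Q p q \<sigma> \<tau> n).
        (case h of (ks, ls, hs) \<Rightarrow> - \<nu> (hd ls) +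
          total_payoff (\<lambda>l k b a. - G k l a b) n lam ls ks (map prod.swap hs)) =
        - (case h of (ks, ls, hs) \<Rightarrow> \<nu> (hd ls) + total_payoff G n lam ks ls hs)"
      by (rule AE_pmfI) (auto dest!: length_play simp: total_payoff_def sum_negf)
  qed auto
  finally show ?thesis by (simp add: payoff2_def)
qed

text \<open>Negation exchanges suprema and infima, and surjective reparametrizations preserve them.
  Working with \<open>has_value\<close> also transports the existence of the value, which
  \<open>game_value\<close> alone does not express.\<close>

lemma has_value_mirror:
  assumes "has_value f v" "surj g" "surj h"
  shows "has_value (\<lambda>t s. - f (g s) (h t)) (- v)"
proof -
  have INF: "(INF x. - F x) = - (SUP x. F x)" for F :: "'x \<Rightarrow> real"
    by (simp add: Inf_real_def image_image)
  have SUP: "(SUP x. - F x) = - (INF x. F x)" for F :: "'x \<Rightarrow> real"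
    by (simp add: Inf_real_def image_image)
  have reindex: "(SUP x. F (e x)) = (SUP x. F x)" "(INF x. F (e x)) = (INF x. F x)"
    if "surj e" for F :: "'x \<Rightarrow> real" and e :: "'y \<Rightarrow> 'x"
    by (simp_all add: image_image[of F e UNIV, symmetric] that)
  have "(INF t. SUP s. f (g s) (h t)) = (INF t. SUP s. f s (h t))"
    by (simp only: reindex(1)[OF assms(2), of "\<lambda>s. f s (h _)"])
  also have "\<dots> = v"
    using reindex(2)[OF assms(3), of "\<lambda>t. SUP s. f s t"] assms(1) by (simp add: has_value_def)
  finally have upper: "(INF t. SUP s. f (g s) (h t)) = v" .
  have "(SUP s. INF t. f (g s) (h t)) = (SUP s. INF t. f (g s) t)"
    by (simp only: reindex(2)[OF assms(3)])
  also have "\<dots> = v"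
    using reindex(1)[OF assms(2), of "\<lambda>s. INF t. f s t"] assms(1) by (simp add: has_value_def)
  finally have lower: "(SUP s. INF t. f (g s) (h t)) = v" .
  show ?thesis unfolding has_value_def INF SUP upper lower by simp
qed

lemma w2_mirror:
  fixes G :: "'k::finite \<Rightarrow> 'l::finite \<Rightarrow> 'a::finite \<Rightarrow> 'b::finite \<Rightarrow> real"
  assumes "0 \<le> lam"
  shows "w2 G P Q n lam p \<nu> =
    - w1 (\<lambda>l k b a. - G k l a b) (\<lambda>b a. Q a b) (\<lambda>b a. P a b) n lam (\<lambda>l. - \<nu> l) p"
proof -
  interpret m: game "\<lambda>l k b a. - G k l a b" "\<lambda>b a. Q a b" "\<lambda>b a. P a b" lam
    by unfold_locales (rule assms)
  have "surj (map_prod id mirror)" "surj mirror"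
    using bij_mirror by (auto simp: bij_def intro!: map_prod_surj)
  from has_value_mirror[OF m.w1_has_value this, of n "\<lambda>l. - \<nu> l" p]
  have "has_value (\<lambda>\<sigma> (q, \<tau>). payoff2 G P Q n lam \<nu> p q \<sigma> \<tau>)
      (- w1 (\<lambda>l k b a. - G k l a b) (\<lambda>b a. Q a b) (\<lambda>b a. P a b) n lam (\<lambda>l. - \<nu> l) p)"
    by (simp add: payoff2_mirror split_def map_prod_def)
  then show ?thesis unfolding w2_def by (rule game_value_eqI)
qed

lemma optimal_stage1_mirror:
  fixes G :: "'k::finite \<Rightarrow> 'l::finite \<Rightarrow> 'a::finite \<Rightarrow> 'b::finite \<Rightarrow> real"
  assumes "0 \<le> lam" "optimal_stage1_player1 G P Q n lam p \<nu> X"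
  shows "optimal_stage1_player2 (\<lambda>l k b a. - G k l a b) (\<lambda>b a. Q a b) (\<lambda>b a. P a b) n lam (\<lambda>l. - \<nu> l) p X"
proof -
  obtain \<sigma> where \<sigma>: "\<And>q \<tau>. w2 G P Q n lam p \<nu> \<le> payoff2 G P Q n lam \<nu> p q \<sigma> \<tau>" "\<And>k. X k = \<sigma> [k] []"
    using assms(2) unfolding optimal_stage1_player1_def by blast
  show ?thesis
    unfolding optimal_stage1_player2_def
  proof (intro exI[of _ "mirror \<sigma>"] conjI allI)
    show "X k = mirror \<sigma> [k] []" for k by (simp add: mirror_def \<sigma>(2))
    fix q \<tau>
    show "payoff1 (\<lambda>l k b a. - G k l a b) (\<lambda>b a. Q a b) (\<lambda>b a. P a b) n lam (\<lambda>l. - \<nu> l) q p \<tau> (mirror \<sigma>)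
      \<le> w1 (\<lambda>l k b a. - G k l a b) (\<lambda>b a. Q a b) (\<lambda>b a. P a b) n lam (\<lambda>l. - \<nu> l) p"
      using \<sigma>(1)[of q "mirror \<tau>"] unfolding w2_mirror[OF assms(1)] payoff2_mirror by simp
  qed
qed

text \<open>Variables that measure payoffs change sign, while the realization weights
  \<open>R\<close> do not; action indices and histories are reordered.\<close>

lemma lp2_feasible_iff_mirror:
  fixes G :: "'k::finite \<Rightarrow> 'l::finite \<Rightarrow> 'a::finite \<Rightarrow> 'b::finite \<Rightarrow> real"
  shows "lp2_feasible G P Q n lam p \<nu> X pplus \<phi> U0 U R \<alpha> \<longleftrightarrow>
    lp1_feasible (\<lambda>l k b a. - G k l a b) (\<lambda>b a. Q a b) (\<lambda>b a. P a b) n lam (\<lambda>l. - \<nu> l) p X (\<lambda>b a. pplus a b)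
      (- \<phi>) (\<lambda>b a. - U0 a b) (\<lambda>b a ls hs. - U a b ls (map prod.swap hs))
      (\<lambda>b a ks hs. R a b ks (map prod.swap hs)) (\<lambda>b a l. - \<alpha> a b l)"
  unfolding lp1_feasible_def lp2_feasible_def
proof (intro arg_cong2[where f = "(\<and>)"])
  have "- \<nu> l + (\<Sum>k\<in>UNIV. \<Sum>a\<in>UNIV. - G k l a b * pmf (X k) a * pmf p k) +
      lam * (\<Sum>k\<in>UNIV. \<Sum>a\<in>UNIV. pmf (X k) a * pmf p k *
        (- U0 a b - (\<Sum>l'\<in>UNIV. pmf (Q a b l) l' * - \<alpha> a b l'))) =
    - (\<nu> l + (\<Sum>k\<in>UNIV. \<Sum>a\<in>UNIV. G k l a b * pmf (X k) a * pmf p k) +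
      lam * (\<Sum>k\<in>UNIV. \<Sum>a\<in>UNIV. pmf (X k) a * pmf p k *
        (U0 a b - (\<Sum>l'\<in>UNIV. pmf (Q a b l) l' * \<alpha> a b l'))))" for b l
  proof -
    have "pmf (X k) a * pmf p k * (- U0 a b - (\<Sum>l'\<in>UNIV. pmf (Q a b l) l' * - \<alpha> a b l')) =
       - (pmf (X k) a * pmf p k * (U0 a b - (\<Sum>l'\<in>UNIV. pmf (Q a b l) l' * \<alpha> a b l')))" for k a
      by (simp add: sum_negf algebra_simps)
    then show ?thesis by (simp add: sum_negf)
  qed
  then show "(\<forall>b l. \<phi> \<le> \<nu> l + (\<Sum>k\<in>UNIV. \<Sum>a\<in>UNIV. G k l a b * pmf (X k) a * pmf p k) +
      lam * (\<Sum>k\<in>UNIV. \<Sum>a\<in>UNIV. pmf (X k) a * pmf p k *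
        (U0 a b - (\<Sum>l'\<in>UNIV. pmf (Q a b l) l' * \<alpha> a b l')))) =
    (\<forall>b l. - \<nu> l + (\<Sum>k\<in>UNIV. \<Sum>a\<in>UNIV. - G k l a b * pmf (X k) a * pmf p k) +
      lam * (\<Sum>k\<in>UNIV. \<Sum>a\<in>UNIV. pmf (X k) a * pmf p k *
        (- U0 a b - (\<Sum>l'\<in>UNIV. pmf (Q a b l) l' * - \<alpha> a b l'))) \<le> - \<phi>)"
    by (simp only: neg_le_iff_le)
next
  have "- \<alpha> a b l + - U a b [l] [] \<le> - U0 a b \<longleftrightarrow> U0 a b \<le> \<alpha> a b l + U a b [l] []" for a b l
    by linarith
  then show "(\<forall>a b l. U0 a b \<le> \<alpha> a b l + U a b [l] []) =
      (\<forall>b a l. - \<alpha> a b l + - U a b [l] (map prod.swap []) \<le> - U0 a b)"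
    by simp blast
next
  have "(\<Sum>ks | length ks = s. \<Sum>as\<in>UNIV. R a b ks hs as * lam ^ (s - 1) * - G (last ks) (last ls) as bs) +
      (\<Sum>l'\<in>UNIV. \<Sum>as\<in>UNIV. pmf (Q as bs (last ls)) l' * - U a b (ls @ [l']) (hs @ [(as, bs)]))
        \<le> - U a b ls hs \<longleftrightarrow>
      (\<Sum>ks | length ks = s. \<Sum>as\<in>UNIV. R a b ks hs as * lam ^ (s - 1) * G (last ks) (last ls) as bs) +
      (\<Sum>l'\<in>UNIV. \<Sum>as\<in>UNIV. pmf (Q as bs (last ls)) l' * U a b (ls @ [l']) (hs @ [(as, bs)]))
        \<ge> U a b ls hs" for s ls hs a b bs
    by (simp add: sum_negf) linarith
  then show "(\<forall>a b. \<forall>s\<in>{1..n - 1}. \<forall>ls hs bs. is_info s ls hs \<longrightarrow> U a b ls hs \<le>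
      (\<Sum>ks | length ks = s. \<Sum>as\<in>UNIV. R a b ks hs as * lam ^ (s - 1) * G (last ks) (last ls) as bs) +
      (\<Sum>l'\<in>UNIV. \<Sum>as\<in>UNIV. pmf (Q as bs (last ls)) l' * U a b (ls @ [l']) (hs @ [(as, bs)]))) =
    (\<forall>b a. \<forall>s\<in>{1..n - 1}. \<forall>ls hs bs. is_info s ls hs \<longrightarrow>
      (\<Sum>ks | length ks = s. \<Sum>as\<in>UNIV. R a b ks (map prod.swap hs) as * lam ^ (s - 1) * - G (last ks) (last ls) as bs) +
      (\<Sum>l'\<in>UNIV. \<Sum>as\<in>UNIV. pmf (Q as bs (last ls)) l' * - U a b (ls @ [l']) (map prod.swap (hs @ [(bs, as)])))
        \<le> - U a b ls (map prod.swap hs))"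
    by (subst (2) all_mirrored[symmetric]) (simp, blast)
next
  show "(\<forall>a b. \<forall>t\<in>{2..n - 1}. \<forall>ks hs a' b' k'. is_info (t - 1) ks hs \<longrightarrow>
      sum (R a b (ks @ [k']) (hs @ [(a', b')])) UNIV = pmf (P a' b' (last ks)) k' * R a b ks hs a') =
    (\<forall>b a. \<forall>t\<in>{2..n - 1}. \<forall>ks hs b' a' k'. is_info (t - 1) ks hs \<longrightarrow>
      sum (R a b (ks @ [k']) (map prod.swap (hs @ [(b', a')]))) UNIV =
      pmf (P a' b' (last ks)) k' * R a b ks (map prod.swap hs) a')"
    by (subst (2) all_mirrored[symmetric]) (simp, blast)
next
  show "(\<forall>a b ls hs. is_info n ls hs \<longrightarrow> U a b ls hs = 0) =
      (\<forall>b a ls hs. is_info n ls hs \<longrightarrow> - U a b ls (map prod.swap hs) = 0)"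
    by (subst (2) all_mirrored[symmetric]) (simp, blast)
next
  show "(\<forall>a b. \<forall>t\<in>{1..n - 1}. \<forall>ks hs ac. is_info t ks hs \<longrightarrow> 0 \<le> R a b ks hs ac) =
      (\<forall>b a. \<forall>t\<in>{1..n - 1}. \<forall>ks hs ac. is_info t ks hs \<longrightarrow> 0 \<le> R a b ks (map prod.swap hs) ac)"
    by (subst (2) all_mirrored[symmetric]) (simp, blast)
qed auto

lemma lp2_optimal_iff_mirror:
  fixes G :: "'k::finite \<Rightarrow> 'l::finite \<Rightarrow> 'a::finite \<Rightarrow> 'b::finite \<Rightarrow> real"
  shows "lp2_optimal G P Q n lam p \<nu> X pplus \<phi> U0 U R \<alpha> \<longleftrightarrow>
    lp1_optimal (\<lambda>l k b a. - G k l a b) (\<lambda>b a. Q a b) (\<lambda>b a. P a b) n lam (\<lambda>l. - \<nu> l) p X (\<lambda>b a. pplus a b)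
      (- \<phi>) (\<lambda>b a. - U0 a b) (\<lambda>b a ls hs. - U a b ls (map prod.swap hs))
      (\<lambda>b a ks hs. R a b ks (map prod.swap hs)) (\<lambda>b a l. - \<alpha> a b l)"
proof -
  let ?lp1 = "lp1_feasible (\<lambda>l k b a. - G k l a b) (\<lambda>b a. Q a b) (\<lambda>b a. P a b) n lam (\<lambda>l. - \<nu> l) p X (\<lambda>b a. pplus a b)"
  let ?lp2 = "lp2_feasible G P Q n lam p \<nu> X pplus"
  have "(\<forall>\<phi>' U0' U' R' \<alpha>'. ?lp2 \<phi>' U0' U' R' \<alpha>' \<longrightarrow> \<phi>' \<le> \<phi>) \<longleftrightarrow>
      (\<forall>\<rho> Z0 Z S \<beta>. ?lp1 \<rho> Z0 Z S \<beta> \<longrightarrow> - \<phi> \<le> \<rho>)" (is "?max \<longleftrightarrow> ?min")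
  proof
    assume max: ?max
    show ?min
    proof (intro allI impI)
      fix \<rho> Z0 Z S \<beta>
      assume "?lp1 \<rho> Z0 Z S \<beta>"
      \<comment> \<open>The change of variables is its own inverse up to the order of indices, so
        every competitor in the mirrored program comes from one in the original program.\<close>
      then have "?lp2 (- \<rho>) (\<lambda>a b. - Z0 b a) (\<lambda>a b ls hs. - Z b a ls (map prod.swap hs))
          (\<lambda>a b ks hs. S b a ks (map prod.swap hs)) (\<lambda>a b l. - \<beta> b a l)"
        unfolding lp2_feasible_iff_mirror by simp
      then have "- \<rho> \<le> \<phi>" using max by blast
      then show "- \<phi> \<le> \<rho>" by simp
    qed
  next
    assume min: ?min
    show ?max
    proof (intro allI impI)
      fix \<phi>' U0' U' R' \<alpha>'
      assume "?lp2 \<phi>' U0' U' R' \<alpha>'"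
      then have "- \<phi> \<le> - \<phi>'" unfolding lp2_feasible_iff_mirror using min by blast
      then show "\<phi>' \<le> \<phi>" by simp
    qed
  qed
  then show ?thesis
    unfolding lp2_optimal_def lp1_optimal_def
    by (intro arg_cong2[where f = "(\<and>)"] lp2_feasible_iff_mirror)
qed

lemma vector_objective2_mirror:
  fixes G :: "'k::finite \<Rightarrow> 'l::finite \<Rightarrow> 'a::finite \<Rightarrow> 'b::finite \<Rightarrow> real"
  assumes "0 \<le> lam"
  shows "vector_objective2 G P Q n lam p \<nu> pplus X \<alpha> =
    - vector_objective1 (\<lambda>l k b a. - G k l a b) (\<lambda>b a. Q a b) (\<lambda>b a. P a b) n lam (\<lambda>l. - \<nu> l) p
        (\<lambda>X b a. pplus X a b) X (\<lambda>b a l. - \<alpha> a b l)"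
proof -
  let ?w1 = "w1 (\<lambda>l k b a. - G k l a b) (\<lambda>b a. Q a b) (\<lambda>b a. P a b) (n - 1) lam"
  have "\<nu> l + (\<Sum>k\<in>UNIV. \<Sum>a\<in>UNIV. G k l a b * pmf (X k) a * pmf p k)
      + lam * (\<Sum>a\<in>UNIV. action_prob p X a * (w2 G P Q (n - 1) lam (pplus X a b) (\<alpha> a b)
        - (\<Sum>l'\<in>UNIV. pmf (Q a b l) l' * \<alpha> a b l'))) =
      - (- \<nu> l + (\<Sum>k\<in>UNIV. \<Sum>a\<in>UNIV. - G k l a b * pmf (X k) a * pmf p k)
      + lam * (\<Sum>a\<in>UNIV. action_prob p X a * (?w1 (\<lambda>l. - \<alpha> a b l) (pplus X a b)
        - (\<Sum>l'\<in>UNIV. pmf (Q a b l) l' * - \<alpha> a b l'))))" for b l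
  proof -
    have "action_prob p X a * (?w1 (\<lambda>l. - \<alpha> a b l) (pplus X a b) - (\<Sum>l'\<in>UNIV. pmf (Q a b l) l' * - \<alpha> a b l')) =
       - (action_prob p X a * (w2 G P Q (n - 1) lam (pplus X a b) (\<alpha> a b) - (\<Sum>l'\<in>UNIV. pmf (Q a b l) l' * \<alpha> a b l')))" for a
      by (simp add: w2_mirror[OF assms] sum_negf algebra_simps)
    then show ?thesis by (simp add: sum_negf)
  qed
  then show ?thesis
    unfolding vector_objective2_def vector_objective1_def
    by (simp only: mult_minus_right sum_negf) (simp add: Inf_real_def image_image)
qed

theorem theorem2:
  fixes G :: "'k::finite \<Rightarrow> 'l::finite \<Rightarrow> 'a::finite \<Rightarrow> 'b::finite \<Rightarrow> real"
    and P :: "'a \<Rightarrow> 'b \<Rightarrow> 'k \<Rightarrow> 'k pmf"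
    and Q :: "'a \<Rightarrow> 'b \<Rightarrow> 'l \<Rightarrow> 'l pmf"
    and n :: nat
    and lam :: real
  assumes "\<forall>k l a b. 0 \<le> G k l a b"
    and "n \<ge> 1"
    and "0 < lam" and "lam \<le> 1"
  shows
    "(\<forall>(\<mu> :: 'k \<Rightarrow> real) (q :: 'l pmf) (Y :: 'l \<Rightarrow> 'b pmf)
        (qplus :: ('l \<Rightarrow> 'b pmf) \<Rightarrow> 'a \<Rightarrow> 'b \<Rightarrow> 'l pmf).
        optimal_stage1_player2 G P Q n lam \<mu> q Y \<longrightarrow>
        (\<forall>Y' a b. belief_update (Q a b) q Y' b (qplus Y' a b)) \<longrightarrow>
        (\<exists>Z0 Z S \<beta>. lp1_optimal G P Q n lam \<mu> q Y (qplus Y) (w1 G P Q n lam \<mu> q) Z0 Z S \<beta>) \<and>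
        (\<forall>\<rho> Z0 Z S \<beta>. lp1_optimal G P Q n lam \<mu> q Y (qplus Y) \<rho> Z0 Z S \<beta> \<longrightarrow>
           solves_vector_problem1 G P Q n lam \<mu> q qplus Y \<beta>)) \<and>
     (\<forall>(p :: 'k pmf) (\<nu> :: 'l \<Rightarrow> real) (X :: 'k \<Rightarrow> 'a pmf)
        (pplus :: ('k \<Rightarrow> 'a pmf) \<Rightarrow> 'a \<Rightarrow> 'b \<Rightarrow> 'k pmf).
        optimal_stage1_player1 G P Q n lam p \<nu> X \<longrightarrow>
        (\<forall>X' a b. belief_update (P a b) p X' a (pplus X' a b)) \<longrightarrow>
        (\<exists>U0 U R \<alpha>. lp2_optimal G P Q n lam p \<nu> X (pplus X) (w2 G P Q n lam p \<nu>) U0 U R \<alpha>) \<and>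
        (\<forall>\<phi> U0 U R \<alpha>. lp2_optimal G P Q n lam p \<nu> X (pplus X) \<phi> U0 U R \<alpha> \<longrightarrow>
           solves_vector_problem2 G P Q n lam p \<nu> pplus X \<alpha>))"
proof (intro conjI allI impI, goal_cases)
  case (1 \<mu> q Y qplus)
  interpret game G P Q lam by unfold_locales (use assms(3) in simp)
  show ?case by (rule lp1_correct(1)[OF assms(2,4) 1(1)]) (use 1(2) in blast)
next
  case (2 \<mu> q Y qplus \<rho> Z0 Z S \<beta>)
  interpret game G P Q lam by unfold_locales (use assms(3) in simp)
  show ?case by (rule lp1_correct(2)[where qplus = qplus, OF assms(2,4) 2(1) _ 2(3)]) (use 2(2) in blast)
next
  case (3 p \<nu> X pplus)
  let ?lp1 = "lp1_optimal (\<lambda>l k b a. - G k l a b) (\<lambda>b a. Q a b) (\<lambda>b a. P a b) n lam (\<lambda>l. - \<nu> l) p X (\<lambda>b a. pplus X a b)"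
  have lam: "0 \<le> lam" using assms(3) by simp
  interpret m: game "\<lambda>l k b a. - G k l a b" "\<lambda>b a. Q a b" "\<lambda>b a. P a b" lam
    by unfold_locales (rule lam)
  have "\<exists>Z0 Z S \<beta>. ?lp1 (- w2 G P Q n lam p \<nu>) Z0 Z S \<beta>"
    using m.lp1_correct(1)[OF assms(2,4) optimal_stage1_mirror[OF lam 3(1)], of "\<lambda>X b a. pplus X a b"] 3(2)
    unfolding w2_mirror[OF lam] by simp
  then obtain Z0 Z S \<beta> where "?lp1 (- w2 G P Q n lam p \<nu>) Z0 Z S \<beta>" by blast
  \<comment> \<open>Witnesses are obtained by undoing the change of variables; swapping the action
    pairs twice restores the histories.\<close>
  then have "lp2_optimal G P Q n lam p \<nu> X (pplus X) (w2 G P Q n lam p \<nu>) (\<lambda>a b. - Z0 b a)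
      (\<lambda>a b ls hs. - Z b a ls (map prod.swap hs)) (\<lambda>a b ks hs. S b a ks (map prod.swap hs)) (\<lambda>a b l. - \<beta> b a l)"
    unfolding lp2_optimal_iff_mirror by simp
  then show ?case by blast
next
  case (4 p \<nu> X pplus \<phi> U0 U R \<alpha>)
  have lam: "0 \<le> lam" using assms(3) by simp
  interpret m: game "\<lambda>l k b a. - G k l a b" "\<lambda>b a. Q a b" "\<lambda>b a. P a b" lam
    by unfold_locales (rule lam)
  have "solves_vector_problem1 (\<lambda>l k b a. - G k l a b) (\<lambda>b a. Q a b) (\<lambda>b a. P a b) n lam (\<lambda>l. - \<nu> l) p
      (\<lambda>X b a. pplus X a b) X (\<lambda>b a l. - \<alpha> a b l)"
    by (rule m.lp1_correct(2)[where qplus = "\<lambda>X b a. pplus X a b",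
          OF assms(2,4) optimal_stage1_mirror[OF lam 4(1)] _ 4(3)[unfolded lp2_optimal_iff_mirror]])
      (use 4(2) in blast)
  then show ?case
    unfolding solves_vector_problem1_def solves_vector_problem2_def vector_objective2_mirror[OF lam] w2_mirror[OF lam]
    by auto
qed

end
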